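(* Let $\mathbb P$ be the linear species of finite (nonempty) posets. For finite posets $\mathcal A=(A,\le_A)$, $\mathcal B=(B,\le_B)$ with $A,B$ disjoint and $a\in A$, let $\Omega(\mathcal A,a,\mathcal B)$ be the set of all partial orders $\le$ on $A\sqcup_a B:=(A\setminus\{a\})\sqcup B$ such that (1) the restriction of $\le$ to $B$ is $\le_B$; (2) $B$ is convex in $(A\sqcup_a B,\le)$; (3) the quotient poset $(A\sqcup_a B,\le)/B$ equals $\mathcal A$ when its underlying set $(A\setminus\{a\})\sqcup\{B\}$ is identified with $A$ by sending the point $B$ to $a$. Then the partial compositions (extended bilinearly) $$\mathcal A\circ_a\mathcal B:=\sum_{\le\,\in\,\Omega(\mathcal A,a,\mathcal B)}(A\sqcup_a B,\le)$$ define an operad structure on $\mathbb P$.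
   Context: Fix a field $\mathbf k$. The linear species $\mathbb P$ assigns to a finite nonempty set $A$ the $\mathbf k$-vector space $\mathbb P_A$ freely generated by all partial orders on $A$ (a generator being written as a poset $(A,\le)$); bijections act by relabelling. A subset $B$ of a poset $(P,\le)$ is convex if $x,y\in B$ and $x\le z\le y$ imply $z\in B$. For a nonempty convex subset $B$ of $(P,\le)$, the quotient poset $(P,\le)/B$ is the set $(P\setminus B)\sqcup\{B\}$ with the partial order $\leqslant$ given by: the point $\{B\}$ is $\leqslant$ itself; for $y\in P\setminus B$, $\{B\}\leqslant y$ iff there is $b\in B$ with $b\le y$; for $x\in P\setminus B$, $x\leqslant\{B\}$ iff there is $b\in B$ with $x\le b$; for $x,y\in P\setminus B$, $x\leqslant y$ iff $x\le y$ or there exist $b,b'\in B$ with $x\le b$ and $b'\le y$. An operad structure on a linear species $\mathbb P$, in terms of partial compositions, is a family of linear maps $\circ_a:\mathbb P_A\otimes\mathbb P_B\to\mathbb P_{A\sqcup_a B}$ ($A,B$ disjoint, $a\in A$), natural with respect to relabelling bijections, such that for $X\in\mathbb P_A$, $Y\in\mathbb P_B$, $Z\in\mathbb P_C$ with $A,B,C$ pairwise disjoint: (parallel associativity) $(X\circ_aY)\circ_{a'}Z=(X\circ_{a'}Z)\circ_aY$ for $a\ne a'$ in $A$; (nested associativity) $(X\circ_aY)\circ_bZ=X\circ_a(Y\circ_bZ)$ for $a\in A$, $b\in B$; together with units in $\mathbb P_{\{a\}}$ (here the one-point posets): $1_{\{a\}}\circ_aY=Y$ and $X\circ_a1_{\{b\}}$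 is $X$ with $a$ relabelled $b$. *)

theory Defs
  imports Complex_Main "HOL-Library.Poly_Mapping"
begin

section \<open>Linear species and operads by partial compositions\<close>

text \<open>
  Finite sets are the finite subsets of an arbitrary type \<open>'a\<close>. The spaces of a linear species are
  subspaces of one ambient vector space \<open>'v\<close>. A species is given on nonempty finite sets only;
  nothing is required of the value at the empty set.
\<close>

definition linear_between ::
  "('k \<Rightarrow> 'v \<Rightarrow> 'v) \<Rightarrow> 'v set \<Rightarrow> 'v set \<Rightarrow> ('v \<Rightarrow> 'v::ab_group_add) \<Rightarrow> bool" where
  "linear_between scale V W f \<longleftrightarrow>
     (\<forall>x\<in>V. f x \<in> W) \<and>
     (\<forall>x\<in>V. \<forall>y\<in>V. f (x + y) = f x + f y) \<and>
     (\<forall>c. \<forall>x\<in>V. f (scale c x) = scale c (f x))"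

text \<open>
  \<open>act A \<sigma>\<close> is the image under the functor of the bijection from \<open>A\<close> to \<open>\<sigma> ` A\<close> given by
  a map \<open>\<sigma>\<close> that is injective on \<open>A\<close>.
\<close>

locale linear_species = vector_space scale
  for scale :: "'k::field \<Rightarrow> 'v::ab_group_add \<Rightarrow> 'v" +
  fixes V :: "'a set \<Rightarrow> 'v set"
    and act :: "'a set \<Rightarrow> ('a \<Rightarrow> 'a) \<Rightarrow> 'v \<Rightarrow> 'v"
  assumes subspace_V: "finite A \<Longrightarrow> A \<noteq> {} \<Longrightarrow> subspace (V A)"
    and act_linear:
      "finite A \<Longrightarrow> A \<noteq> {} \<Longrightarrow> inj_on \<sigma> A \<Longrightarrow> linear_between scale (V A) (V (\<sigma> ` A)) (act A \<sigma>)"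
    and act_cong:
      "finite A \<Longrightarrow> A \<noteq> {} \<Longrightarrow> inj_on \<sigma> A \<Longrightarrow> (\<And>x. x \<in> A \<Longrightarrow> \<sigma> x = \<tau> x) \<Longrightarrow> X \<in> V A
        \<Longrightarrow> act A \<sigma> X = act A \<tau> X"
    and act_id: "finite A \<Longrightarrow> A \<noteq> {} \<Longrightarrow> X \<in> V A \<Longrightarrow> act A id X = X"
    and act_comp:
      "finite A \<Longrightarrow> A \<noteq> {} \<Longrightarrow> inj_on \<sigma> A \<Longrightarrow> inj_on \<tau> (\<sigma> ` A) \<Longrightarrow> X \<in> V A
        \<Longrightarrow> act (\<sigma> ` A) \<tau> (act A \<sigma> X) = act A (\<tau> \<circ> \<sigma>) X"

definition insert_at :: "'a set \<Rightarrow> 'a \<Rightarrow> 'a set \<Rightarrow> 'a set" where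
  "insert_at A a B = (A - {a}) \<union> B"

text \<open>
  \<open>comp A a B X Y\<close> stands for \<open>X \<circ>\<^sub>a Y\<close> with \<open>X\<close> in \<open>V A\<close> and \<open>Y\<close> in \<open>V B\<close>. A linear map on the
  tensor product of \<open>V A\<close> and \<open>V B\<close> is given as a bilinear map.
\<close>

locale operad = linear_species scale V act
  for scale :: "'k::field \<Rightarrow> 'v::ab_group_add \<Rightarrow> 'v"
    and V :: "'a set \<Rightarrow> 'v set"
    and act :: "'a set \<Rightarrow> ('a \<Rightarrow> 'a) \<Rightarrow> 'v \<Rightarrow> 'v" +
  fixes comp :: "'a set \<Rightarrow> 'a \<Rightarrow> 'a set \<Rightarrow> 'v \<Rightarrow> 'v \<Rightarrow> 'v"
    and one :: "'a \<Rightarrow> 'v"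
  assumes comp_linear_left:
      "finite A \<Longrightarrow> finite B \<Longrightarrow> B \<noteq> {} \<Longrightarrow> A \<inter> B = {} \<Longrightarrow> a \<in> A \<Longrightarrow> Y \<in> V B
        \<Longrightarrow> linear_between scale (V A) (V (insert_at A a B)) (\<lambda>X. comp A a B X Y)"
    and comp_linear_right:
      "finite A \<Longrightarrow> finite B \<Longrightarrow> B \<noteq> {} \<Longrightarrow> A \<inter> B = {} \<Longrightarrow> a \<in> A \<Longrightarrow> X \<in> V A
        \<Longrightarrow> linear_between scale (V B) (V (insert_at A a B)) (comp A a B X)"
    and comp_natural:
      "finite A \<Longrightarrow> finite B \<Longrightarrow> B \<noteq> {} \<Longrightarrow> A \<inter> B = {} \<Longrightarrow> a \<in> A
        \<Longrightarrow> inj_on \<sigma> A \<Longrightarrow> inj_on \<tau> B \<Longrightarrow> \<sigma> ` A \<inter> \<tau> ` B = {} \<Longrightarrow> X \<in> V A \<Longrightarrow> Y \<in> V B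
        \<Longrightarrow> act (insert_at A a B) (\<lambda>x. if x \<in> B then \<tau> x else \<sigma> x) (comp A a B X Y)
          = comp (\<sigma> ` A) (\<sigma> a) (\<tau> ` B) (act A \<sigma> X) (act B \<tau> Y)"
    and parallel_assoc:
      "finite A \<Longrightarrow> finite B \<Longrightarrow> B \<noteq> {} \<Longrightarrow> finite C \<Longrightarrow> C \<noteq> {}
        \<Longrightarrow> A \<inter> B = {} \<Longrightarrow> A \<inter> C = {} \<Longrightarrow> B \<inter> C = {} \<Longrightarrow> a \<in> A \<Longrightarrow> a' \<in> A \<Longrightarrow> a \<noteq> a'
        \<Longrightarrow> X \<in> V A \<Longrightarrow> Y \<in> V B \<Longrightarrow> Z \<in> V C
        \<Longrightarrow> comp (insert_at A a B) a' C (comp A a B X Y) Z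
          = comp (insert_at A a' C) a B (comp A a' C X Z) Y"
    and nested_assoc:
      "finite A \<Longrightarrow> finite B \<Longrightarrow> finite C \<Longrightarrow> C \<noteq> {}
        \<Longrightarrow> A \<inter> B = {} \<Longrightarrow> A \<inter> C = {} \<Longrightarrow> B \<inter> C = {} \<Longrightarrow> a \<in> A \<Longrightarrow> b \<in> B
        \<Longrightarrow> X \<in> V A \<Longrightarrow> Y \<in> V B \<Longrightarrow> Z \<in> V C
        \<Longrightarrow> comp (insert_at A a B) b C (comp A a B X Y) Z
          = comp A a (insert_at B b C) X (comp B b C Y Z)"
    and one_in: "one a \<in> V {a}"
    and one_natural: "act {a} \<sigma> (one a) = one (\<sigma> a)"
    and unit_left:
      "finite B \<Longrightarrow> B \<noteq> {} \<Longrightarrow> a \<notin> B \<Longrightarrow> Y \<in> V B \<Longrightarrow> comp {a} a B (one a) Y = Y"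
    and unit_right:
      "finite A \<Longrightarrow> a \<in> A \<Longrightarrow> b \<notin> A \<Longrightarrow> X \<in> V A
        \<Longrightarrow> comp A a {b} X (one b) = act A (id(a := b)) X"

section \<open>Quotient posets and the set \<open>\<Omega>\<close>\<close>

definition poset_convex :: "'a set \<Rightarrow> 'a rel \<Rightarrow> 'a set \<Rightarrow> bool" where
  "poset_convex P r B \<longleftrightarrow>
     B \<subseteq> P \<and> (\<forall>x\<in>B. \<forall>y\<in>B. \<forall>z\<in>P. (x, z) \<in> r \<and> (z, y) \<in> r \<longrightarrow> z \<in> B)"

text \<open>The quotient lives on the disjoint union of \<open>P - B\<close> and the set whose only point is \<open>B\<close>.\<close>

definition quotient_set :: "'a set \<Rightarrow> 'a set \<Rightarrow> ('a + 'a set) set" where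
  "quotient_set P B = (P - B) <+> {B}"

definition quotient_rel :: "'a set \<Rightarrow> 'a rel \<Rightarrow> 'a set \<Rightarrow> ('a + 'a set) rel" where
  "quotient_rel P r B =
     {(Inr B, Inr B)}
     \<union> {(Inr B, Inl y) |y. y \<in> P - B \<and> (\<exists>b\<in>B. (b, y) \<in> r)}
     \<union> {(Inl x, Inr B) |x. x \<in> P - B \<and> (\<exists>b\<in>B. (x, b) \<in> r)}
     \<union> {(Inl x, Inl y) |x y. x \<in> P - B \<and> y \<in> P - B \<and>
          ((x, y) \<in> r \<or> (\<exists>b\<in>B. \<exists>b'\<in>B. (x, b) \<in> r \<and> (b', y) \<in> r))}"

definition block_to :: "'a \<Rightarrow> 'a + 'a set \<Rightarrow> 'a" where
  "block_to a = case_sum id (\<lambda>_. a)"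

definition Omega :: "'a set \<Rightarrow> 'a rel \<Rightarrow> 'a \<Rightarrow> 'a set \<Rightarrow> 'a rel \<Rightarrow> 'a rel set" where
  "Omega A rA a B rB =
     {r. partial_order_on (insert_at A a B) r \<and>
         r \<inter> (B \<times> B) = rB \<and>
         poset_convex (insert_at A a B) r B \<and>
         block_to a ` quotient_set (insert_at A a B) B = A \<and>
         map_prod (block_to a) (block_to a) ` quotient_rel (insert_at A a B) r B = rA}"

section \<open>The species of posets and its partial compositions\<close>

text \<open>
  A poset is represented by its order relation, which determines the underlying set by
  reflexivity. The ambient space is the free vector space on all relations.
\<close>

definition fscale :: "'k::field \<Rightarrow> ('b \<Rightarrow>\<^sub>0 'k) \<Rightarrow> ('b \<Rightarrow>\<^sub>0 'k)" where
  "fscale c = Poly_Mapping.map ((*) c)"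

definition lin_extend :: "('b \<Rightarrow> ('c \<Rightarrow>\<^sub>0 'k)) \<Rightarrow> ('b \<Rightarrow>\<^sub>0 'k) \<Rightarrow> ('c \<Rightarrow>\<^sub>0 'k::field)" where
  "lin_extend f X = (\<Sum>r\<in>Poly_Mapping.keys X. fscale (Poly_Mapping.lookup X r) (f r))"

definition gen :: "'b \<Rightarrow> ('b \<Rightarrow>\<^sub>0 'k::field)" where
  "gen r = Poly_Mapping.single r 1"

definition poset_space :: "'a set \<Rightarrow> ('a rel \<Rightarrow>\<^sub>0 'k::field) set" where
  "poset_space A = {X. Poly_Mapping.keys X \<subseteq> {r. partial_order_on A r}}"

definition poset_act :: "'a set \<Rightarrow> ('a \<Rightarrow> 'a) \<Rightarrow> ('a rel \<Rightarrow>\<^sub>0 'k::field) \<Rightarrow> ('a rel \<Rightarrow>\<^sub>0 'k)" where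
  "poset_act A \<sigma> = lin_extend (\<lambda>r. gen (map_prod \<sigma> \<sigma> ` r))"

definition poset_comp ::
  "'a set \<Rightarrow> 'a \<Rightarrow> 'a set \<Rightarrow> ('a rel \<Rightarrow>\<^sub>0 'k::field) \<Rightarrow> ('a rel \<Rightarrow>\<^sub>0 'k) \<Rightarrow> ('a rel \<Rightarrow>\<^sub>0 'k)" where
  "poset_comp A a B X Y =
     lin_extend (\<lambda>rA. lin_extend (\<lambda>rB. \<Sum>r\<in>Omega A rA a B rB. gen r) Y) X"

definition poset_one :: "'a \<Rightarrow> ('a rel \<Rightarrow>\<^sub>0 'k::field)" where
  "poset_one a = gen {(a, a)}"

end

theory Submission
  imports Defs
begin

text \<open>
  Write \<open>s/B\<close> for the quotient of a poset \<open>s\<close> by a convex block \<open>B\<close>. By bilinearity all axioms reduce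
  to statements about the sets \<open>\<Omega>\<close>. In an iterated composition of generators every order \<open>s\<close> on the final
  set occurs at most once, because the intermediate order is recovered from \<open>s\<close>: it is \<open>s/C\<close> if
  \<open>C\<close> was inserted last, and the restriction of \<open>s\<close> to the inserted block if that block is itself a
  composite. So both sides of an associativity law are sums over sets of orders, and these
  sets coincide. For nested associativity, with \<open>D = B \<squnion>\<^sub>b C\<close>, one has \<open>(s/C)/B = s/D\<close> and
  \<open>(s/C)|B = (s|D)/C\<close>, and \<open>B\<close> is convex in \<open>s/C\<close> iff \<open>D\<close> is convex in \<open>s\<close>. For parallel
  associativity \<open>(s/C)/B = (s/B)/C\<close>; here convexity of \<open>B\<close> in \<open>s/C\<close> forbids that some
  point of \<open>B\<close> lies below a point of \<open>C\<close> while some point of \<open>B\<close> lies above a point of \<open>C\<close>, so the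
  restrictions to \<open>B\<close> and to \<open>C\<close> are not altered by the other quotient.
\<close>

section \<open>Linear extension on free vector spaces\<close>

lemma lookup_fscale [simp]: "Poly_Mapping.lookup (fscale c X) r = c * Poly_Mapping.lookup X r"
  by (simp add: fscale_def map.rep_eq when_def)

lemma lookup_gen: "Poly_Mapping.lookup (gen r) s = (if r = s then 1 else 0)"
  by (simp add: gen_def lookup_single when_def)

lemma keys_gen [simp]: "Poly_Mapping.keys (gen r :: 'b \<Rightarrow>\<^sub>0 'k::field) = {r}"
  by (simp add: gen_def)

lemma vector_space_fscale: "vector_space (fscale :: 'k::field \<Rightarrow> ('b \<Rightarrow>\<^sub>0 'k) \<Rightarrow> _)"
  by unfold_locales (auto intro!: poly_mapping_eqI simp: lookup_add algebra_simps)

interpretation free: vector_space "fscale :: 'k::field \<Rightarrow> ('b \<Rightarrow>\<^sub>0 'k) \<Rightarrow> _"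
  by (rule vector_space_fscale)

text \<open>Additional indices carry the coefficient zero. Vectors with different supports can
  therefore be expanded over one common finite set, which is what additivity needs.\<close>

lemma lin_extend_superset:
  assumes "finite S" "Poly_Mapping.keys X \<subseteq> S"
  shows "lin_extend f X = (\<Sum>r\<in>S. fscale (Poly_Mapping.lookup X r) (f r))"
  unfolding lin_extend_def
  by (rule sum.mono_neutral_left) (use assms in \<open>auto simp: in_keys_iff\<close>)

lemma lin_extend_add: "lin_extend f (X + Y) = lin_extend f X + lin_extend f Y"
proof -
  let ?S = "Poly_Mapping.keys X \<union> Poly_Mapping.keys Y"
  have "Poly_Mapping.keys (X + Y) \<subseteq> ?S" by (rule Poly_Mapping.keys_add)
  then show ?thesis
    by (simp add: lin_extend_superset[of ?S] lookup_add free.scale_left_distrib sum.distrib)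
qed

lemma lin_extend_scale: "lin_extend f (fscale c X) = fscale c (lin_extend f X)"
proof -
  have "Poly_Mapping.keys (fscale c X) \<subseteq> Poly_Mapping.keys X"
    by (auto simp: in_keys_iff)
  then show ?thesis
    by (simp add: lin_extend_superset[of "Poly_Mapping.keys X"] free.scale_sum_right)
qed

lemma lin_extend_zero [simp]: "lin_extend f 0 = 0"
  by (simp add: lin_extend_def)

lemma lin_extend_sum: "lin_extend f (\<Sum>i\<in>I. g i) = (\<Sum>i\<in>I. lin_extend f (g i))"
  by (induction I rule: infinite_finite_induct) (simp_all add: lin_extend_add)

lemma lin_extend_gen [simp]: "lin_extend f (gen r) = f r"
  by (simp add: lin_extend_def lookup_gen)

lemma lin_extend_gen_id: "lin_extend gen X = X"
  by (rule poly_mapping_eqI)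
     (auto simp: lin_extend_def lookup_sum lookup_gen in_keys_iff if_distrib[of "(*) _"] cong: if_cong)

lemma lin_extend_lin_extend:
  "lin_extend g (lin_extend f X) = lin_extend (\<lambda>r. lin_extend g (f r)) X"
  by (simp add: lin_extend_def[of f] lin_extend_def[of "\<lambda>r. lin_extend g (f r)"]
      lin_extend_sum lin_extend_scale)

text \<open>Only generators that occur in \<open>X\<close> matter. For \<open>X\<close> in
  \<open>poset_space A\<close> the values may thus be compared under the assumption that
  \<open>r\<close> is a partial order on \<open>A\<close>.\<close>

lemma lin_extend_cong:
  "(\<And>r. r \<in> Poly_Mapping.keys X \<Longrightarrow> f r = g r) \<Longrightarrow> lin_extend f X = lin_extend g X"
  by (simp add: lin_extend_def)

text \<open>Additivity in the extended function rather than in the vector. It makes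
  \<open>poset_comp\<close> additive in its second argument, which sits inside the outer
  extension.\<close>

lemma lin_extend_fun_add: "lin_extend (\<lambda>r. f r + g r) X = lin_extend f X + lin_extend g X"
  by (simp add: lin_extend_def free.scale_right_distrib sum.distrib)

lemma lin_extend_fun_scale: "lin_extend (\<lambda>r. fscale c (f r)) X = fscale c (lin_extend f X)"
  by (simp add: lin_extend_def free.scale_sum_right mult.commute)

lemma lin_extend_fun_sum: "lin_extend (\<lambda>r. \<Sum>i\<in>I. f i r) X = (\<Sum>i\<in>I. lin_extend (f i) X)"
  unfolding lin_extend_def free.scale_sum_right by (rule sum.swap)

text \<open>Interchange of two finite sums. The two sides of parallel associativity expand the
  inserted vectors in opposite orders, and this reconciles them.\<close>

lemma lin_extend_swap:
  "lin_extend (\<lambda>r. lin_extend (f r) Y) X = lin_extend (\<lambda>s. lin_extend (\<lambda>r. f r s) X) Y"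
  unfolding lin_extend_def free.scale_sum_right
  by (subst sum.swap) (simp add: mult.commute)

section \<open>Subspaces spanned by the partial orders on a set\<close>

lemma subspace_poset_space: "free.subspace (poset_space A :: ('a rel \<Rightarrow>\<^sub>0 'k::field) set)"
proof (unfold free.subspace_def poset_space_def, intro conjI ballI allI; clarsimp)
  fix X Y :: "'a rel \<Rightarrow>\<^sub>0 'k" and r
  assume "Poly_Mapping.keys X \<subseteq> {r. partial_order_on A r}"
    "Poly_Mapping.keys Y \<subseteq> {r. partial_order_on A r}"
    "r \<in> Poly_Mapping.keys (X + Y)"
  then show "partial_order_on A r" using Poly_Mapping.keys_add[of X Y] by blast
next
  fix X :: "'a rel \<Rightarrow>\<^sub>0 'k" and c r
  assume "Poly_Mapping.keys X \<subseteq> {r. partial_order_on A r}"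
    "r \<in> Poly_Mapping.keys (fscale c X)"
  then show "partial_order_on A r" by (auto simp: in_keys_iff)
qed

lemma lin_extend_in_poset_space:
  assumes "\<And>r. r \<in> Poly_Mapping.keys X \<Longrightarrow> f r \<in> poset_space A"
  shows "lin_extend f X \<in> poset_space A"
  unfolding lin_extend_def
  by (intro free.subspace_sum free.subspace_scale subspace_poset_space assms)

lemma gen_in_poset_space: "partial_order_on A r \<Longrightarrow> gen r \<in> poset_space A"
  by (simp add: poset_space_def)

lemma poset_space_keysD:
  "X \<in> poset_space A \<Longrightarrow> r \<in> Poly_Mapping.keys X \<Longrightarrow> partial_order_on A r"
  by (auto simp: poset_space_def)

section \<open>Contracting a block of a poset\<close>

text \<open>
  The quotient by \<open>B\<close> with the block renamed to \<open>a\<close>: \<open>Omega\<close> transports the quotient from a sum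
  type back to \<open>A\<close>, and \<open>contract_image_quotient\<close> identifies the result with \<open>contract B a r\<close>.
\<close>

definition contract :: "'a set \<Rightarrow> 'a \<Rightarrow> 'a rel \<Rightarrow> 'a rel" where
  "contract B a r =
    (let p = (\<lambda>x. if x \<in> B then a else x) in map_prod p p ` (r \<union> r O (B \<times> B) O r))"

lemma partial_order_on_iff:
  "partial_order_on A r \<longleftrightarrow> r \<subseteq> A \<times> A \<and> (\<forall>x\<in>A. (x, x) \<in> r) \<and>
    (\<forall>x y z. (x, y) \<in> r \<longrightarrow> (y, z) \<in> r \<longrightarrow> (x, z) \<in> r) \<and>
    (\<forall>x y. (x, y) \<in> r \<longrightarrow> (y, x) \<in> r \<longrightarrow> x = y)"
  unfolding partial_order_on_def preorder_on_def refl_on_def trans_def antisym_def by blast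

lemma map_prod_image_iff:
  "(x, y) \<in> map_prod f g ` S \<longleftrightarrow> (\<exists>u v. x = f u \<and> y = g v \<and> (u, v) \<in> S)"
  unfolding image_iff Bex_def split_paired_Ex by auto

text \<open>As \<open>a\<close> is outside \<open>P\<close>, the renaming sends exactly the points
  of \<open>B\<close> to \<open>a\<close> and fixes the rest of \<open>P\<close>, so preimages can
  be solved for. Reflexivity on the nonempty block supplies the pair \<open>(a, a)\<close>. Only a
  carrier bound and reflexivity on \<open>B\<close> are assumed, so that the formula also applies to
  restrictions and to relations that are themselves contractions.\<close>

lemma contract_iff:
  assumes "r \<subseteq> P \<times> P" "\<forall>b\<in>B. (b, b) \<in> r" "B \<noteq> {}" "a \<notin> P"
  shows "(x, y) \<in> contract B a r \<longleftrightarrow>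
    (if x = a then y = a \<or> y \<notin> B \<and> (\<exists>b\<in>B. (b, y) \<in> r)
     else x \<notin> B \<and>
      (if y = a then \<exists>b\<in>B. (x, b) \<in> r
       else y \<notin> B \<and> ((x, y) \<in> r \<or> (\<exists>b\<in>B. (x, b) \<in> r) \<and> (\<exists>b\<in>B. (b, y) \<in> r))))"
proof -
  have *: "(x, y) \<in> contract B a r \<longleftrightarrow> (\<exists>u v. x = (if u \<in> B then a else u) \<and>
    y = (if v \<in> B then a else v) \<and>
    ((u, v) \<in> r \<or> (\<exists>b\<in>B. \<exists>b'\<in>B. (u, b) \<in> r \<and> (b', v) \<in> r)))"
    unfolding contract_def Let_def map_prod_image_iff by blast
  have P: "u \<in> P" "v \<in> P" if "(u, v) \<in> r \<or> (\<exists>b\<in>B. \<exists>b'\<in>B. (u, b) \<in> r \<and> (b', v) \<in> r)" for u v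
    using assms(1) that by blast+
  have c: "x = (if u \<in> B then a else u) \<longleftrightarrow> (if x = a then u \<in> B else u = x \<and> x \<notin> B)"
    if "u \<in> P" for u x
    using that assms(4) by auto
  have **: "(x, y) \<in> contract B a r \<longleftrightarrow> (\<exists>u v. (if x = a then u \<in> B else u = x \<and> x \<notin> B) \<and>
    (if y = a then v \<in> B else v = y \<and> y \<notin> B) \<and>
    ((u, v) \<in> r \<or> (\<exists>b\<in>B. \<exists>b'\<in>B. (u, b) \<in> r \<and> (b', v) \<in> r)))"
    unfolding *
  proof (rule ex_cong1, rule ex_cong1)
    fix u v
    show "x = (if u \<in> B then a else u) \<and> y = (if v \<in> B then a else v) \<and>
      ((u, v) \<in> r \<or> (\<exists>b\<in>B. \<exists>b'\<in>B. (u, b) \<in> r \<and> (b', v) \<in> r)) \<longleftrightarrow>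
      (if x = a then u \<in> B else u = x \<and> x \<notin> B) \<and> (if y = a then v \<in> B else v = y \<and> y \<notin> B) \<and>
      ((u, v) \<in> r \<or> (\<exists>b\<in>B. \<exists>b'\<in>B. (u, b) \<in> r \<and> (b', v) \<in> r))" (is "?L \<and> ?M \<and> ?R \<longleftrightarrow> ?L' \<and> ?M' \<and> ?R")
    \<comment> \<open>The inversion \<open>c\<close> is valid only for points of \<open>P\<close>.
      Membership in \<open>P\<close> follows from \<open>?R\<close>; if \<open>?R\<close> fails,
      both sides are false.\<close>
    proof (cases ?R)
      case True
      then show ?thesis by (simp only: c[OF P(1)[OF True], of x] c[OF P(2)[OF True], of y] simp_thms)
    next
      case False
      then show ?thesis by blast
    qed
  qed
  obtain b0 where b0: "b0 \<in> B" "(b0, b0) \<in> r"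
    using assms(2,3) by blast
  consider "x = a" "y = a" | "x = a" "y \<noteq> a" | "x \<noteq> a" "y = a" | "x \<noteq> a" "y \<noteq> a" by blast
  then show ?thesis
  proof cases
    case 1
    show ?thesis unfolding ** using 1 b0 by auto
  next
    case 2
    show ?thesis unfolding ** using 2 assms(2) by simp blast
  next
    case 3
    show ?thesis unfolding ** using 3 assms(2) by simp blast
  next
    case 4
    show ?thesis unfolding ** using 4 by simp
  qed
qed

lemma contract_image_quotient:
  assumes "r \<subseteq> P \<times> P" "\<forall>b\<in>B. (b, b) \<in> r" "B \<noteq> {}" "a \<notin> P"
  shows "map_prod (block_to a) (block_to a) ` quotient_rel P r B = contract B a r"
proof -
  have "(x, y) \<in> map_prod (block_to a) (block_to a) ` quotient_rel P r B
     \<longleftrightarrow> (x, y) \<in> contract B a r" for x y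
  proof -
    have "(x, y) \<in> map_prod (block_to a) (block_to a) ` quotient_rel P r B \<longleftrightarrow>
      (x = a \<and> y = a) \<or> (x = a \<and> y \<in> P - B \<and> (\<exists>b\<in>B. (b, y) \<in> r)) \<or>
      (y = a \<and> x \<in> P - B \<and> (\<exists>b\<in>B. (x, b) \<in> r)) \<or>
      (x \<in> P - B \<and> y \<in> P - B \<and>
        ((x, y) \<in> r \<or> (\<exists>b\<in>B. \<exists>b'\<in>B. (x, b) \<in> r \<and> (b', y) \<in> r)))"
      unfolding map_prod_image_iff split_sum_ex
      by (simp add: quotient_rel_def block_to_def) blast
    also have "\<dots> \<longleftrightarrow> (x, y) \<in> contract B a r"
      unfolding contract_iff[OF assms]
      using assms(1,4) by (cases "x = a"; cases "y = a"; simp; blast)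
    finally show ?thesis .
  qed
  then show ?thesis by auto
qed

text \<open>The underlying set of the quotient is computed to be \<open>A\<close>, and its order
  becomes \<open>contract B a r\<close>, since \<open>a\<close> lies outside
  \<open>insert_at A a B\<close>. This is the working form of membership in \<open>Omega\<close>
  from here on.\<close>

lemma Omega_iff:
  assumes "a \<in> A" "A \<inter> B = {}" "B \<noteq> {}"
  shows "r \<in> Omega A rA a B rB \<longleftrightarrow>
    partial_order_on (insert_at A a B) r \<and> r \<inter> (B \<times> B) = rB \<and>
    poset_convex (insert_at A a B) r B \<and> contract B a r = rA"
proof -
  have "block_to a ` quotient_set (insert_at A a B) B = A"
    using assms by (auto simp: block_to_def quotient_set_def insert_at_def image_iff Plus_def)
  moreover have "map_prod (block_to a) (block_to a) ` quotient_rel (insert_at A a B) r B = contract B a r"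
    if "partial_order_on (insert_at A a B) r"
    by (rule contract_image_quotient)
      (use that assms in \<open>auto simp: partial_order_on_iff insert_at_def\<close>)
  ultimately show ?thesis
    unfolding Omega_def by auto
qed

lemma contract_subset:
  assumes "r \<subseteq> P \<times> P" "\<forall>b\<in>B. (b, b) \<in> r" "B \<noteq> {}" "a \<notin> P"
  shows "contract B a r \<subseteq> insert a (P - B) \<times> insert a (P - B)"
proof clarify
  fix x y assume "(x, y) \<in> contract B a r"
  then show "x \<in> insert a (P - B) \<and> y \<in> insert a (P - B)"
    unfolding contract_iff[OF assms] using assms(1) by (auto split: if_splits)
qed

lemma contract_refl:
  assumes "r \<subseteq> P \<times> P" "\<forall>b\<in>P. (b, b) \<in> r" "B \<noteq> {}" "a \<notin> P" "B \<subseteq> P" "x \<in> insert a (P - B)"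
  shows "(x, x) \<in> contract B a r"
proof -
  have "\<forall>b\<in>B. (b, b) \<in> r" using assms(2,5) by blast
  from contract_iff[OF assms(1) this assms(3,4)] show ?thesis using assms(2,6) by auto
qed

text \<open>Transitivity: a chain that passes through the block several times can be replaced by its
  first entry and its last exit. Antisymmetry is where convexity enters: a cycle through the block
  would place an outside point between two points of \<open>B\<close>.\<close>

lemma partial_order_on_contract:
  assumes "partial_order_on P r" "poset_convex P r B" "B \<noteq> {}" "a \<notin> P"
  shows "partial_order_on (insert a (P - B)) (contract B a r)"
proof -
  have r: "r \<subseteq> P \<times> P" "\<forall>x\<in>P. (x, x) \<in> r"
    and tr: "\<And>x y z. (x, y) \<in> r \<Longrightarrow> (y, z) \<in> r \<Longrightarrow> (x, z) \<in> r"
    and as: "\<And>x y. (x, y) \<in> r \<Longrightarrow> (y, x) \<in> r \<Longrightarrow> x = y"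
    using assms(1) unfolding partial_order_on_iff by blast+
  have B: "B \<subseteq> P" and cv: "\<And>x y z. x \<in> B \<Longrightarrow> y \<in> B \<Longrightarrow> (x, z) \<in> r \<Longrightarrow> (z, y) \<in> r \<Longrightarrow> z \<in> B"
    using assms(2) r(1) unfolding poset_convex_def by blast+
  have iff: "(x, y) \<in> contract B a r \<longleftrightarrow>
    (if x = a then y = a \<or> y \<notin> B \<and> (\<exists>b\<in>B. (b, y) \<in> r)
     else x \<notin> B \<and>
      (if y = a then \<exists>b\<in>B. (x, b) \<in> r
       else y \<notin> B \<and> ((x, y) \<in> r \<or> (\<exists>b\<in>B. (x, b) \<in> r) \<and> (\<exists>b\<in>B. (b, y) \<in> r))))" for x y
    by (rule contract_iff) (use r B assms in auto)
  show ?thesis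
    unfolding partial_order_on_iff
  proof (intro conjI allI impI ballI)
    show "contract B a r \<subseteq> insert a (P - B) \<times> insert a (P - B)"
      by (rule contract_subset) (use r B assms in auto)
    show "(x, x) \<in> contract B a r" if "x \<in> insert a (P - B)" for x
      by (rule contract_refl) (use r B assms that in auto)
    show "(x, z) \<in> contract B a r" if "(x, y) \<in> contract B a r" "(y, z) \<in> contract B a r" for x y z
      using that unfolding iff
      by (cases "x = a"; cases "y = a"; cases "z = a"; simp; meson tr cv)
    show "x = y" if "(x, y) \<in> contract B a r" "(y, x) \<in> contract B a r" for x y
      using that unfolding iff
      by (cases "x = a"; cases "y = a"; simp; meson as tr cv)
  qed
qed

lemma rel_eqI:
  assumes "r \<subseteq> A \<times> A" "s \<subseteq> A \<times> A"
    and "\<And>x y. x \<in> A \<Longrightarrow> y \<in> A \<Longrightarrow> (x, y) \<in> r \<longleftrightarrow> (x, y) \<in> s"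
  shows "r = s"
  using assms by (intro set_eqI) (clarify, blast)

section \<open>Iterated contractions\<close>

text \<open>A relation from \<open>z\<close> into \<open>B\<close> that is new in the quotient by
  \<open>C\<close> passes through \<open>C\<close>, so \<open>z\<close> already lies below a point
  of \<open>C\<close>, which belongs to the composite block.\<close>

lemma contract_below_iff:
  assumes s: "s \<subseteq> P \<times> P" "\<forall>x\<in>P. (x, x) \<in> s" and C: "C \<noteq> {}" "C \<subseteq> P" and b: "b \<notin> P"
    and B: "b \<in> B" "B \<subseteq> insert b (P - C)" and z: "z \<in> P - insert_at B b C"
  shows "(\<exists>c\<in>B. (z, c) \<in> contract C b s) \<longleftrightarrow> (\<exists>c\<in>insert_at B b C. (z, c) \<in> s)"
proof -
  let ?D = "insert_at B b C" and ?Q = "contract C b s"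
  have rC: "\<forall>c\<in>C. (c, c) \<in> s" using s C by blast
  note iC = contract_iff[OF s(1) rC C(1) b]
  have D: "x \<in> ?D \<longleftrightarrow> x \<in> B \<and> x \<noteq> b \<or> x \<in> C" for x
    using B C b by (auto simp: insert_at_def)
  have BC: "x \<notin> C" if "x \<in> B" for x
    using that B b C by blast
  have x: "z \<noteq> b" "z \<notin> C" using z b D by auto
  have "(z, b) \<in> ?Q \<longleftrightarrow> (\<exists>c\<in>C. (z, c) \<in> s)"
    using x by (simp add: iC)
  moreover have "(z, c) \<in> ?Q \<longleftrightarrow> (z, c) \<in> s \<or> (\<exists>c\<in>C. (z, c) \<in> s) \<and> (\<exists>c'\<in>C. (c', c) \<in> s)"
    if "c \<in> B" "c \<noteq> b" for c
    using x BC[OF that(1)] that(2) by (simp add: iC)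
  ultimately show ?thesis unfolding Bex_def D using B(1) by blast
qed

text \<open>The order dual of \<open>contract_below_iff\<close>.\<close>

lemma contract_above_iff:
  assumes s: "s \<subseteq> P \<times> P" "\<forall>x\<in>P. (x, x) \<in> s" and C: "C \<noteq> {}" "C \<subseteq> P" and b: "b \<notin> P"
    and B: "b \<in> B" "B \<subseteq> insert b (P - C)" and z: "z \<in> P - insert_at B b C"
  shows "(\<exists>c\<in>B. (c, z) \<in> contract C b s) \<longleftrightarrow> (\<exists>c\<in>insert_at B b C. (c, z) \<in> s)"
proof -
  let ?D = "insert_at B b C" and ?Q = "contract C b s"
  have rC: "\<forall>c\<in>C. (c, c) \<in> s" using s C by blast
  note iC = contract_iff[OF s(1) rC C(1) b]
  have D: "x \<in> ?D \<longleftrightarrow> x \<in> B \<and> x \<noteq> b \<or> x \<in> C" for x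
    using B C b by (auto simp: insert_at_def)
  have BC: "x \<notin> C" if "x \<in> B" for x
    using that B b C by blast
  have y: "z \<noteq> b" "z \<notin> C" using z b D by auto
  have "(b, z) \<in> ?Q \<longleftrightarrow> (\<exists>c\<in>C. (c, z) \<in> s)"
    using y by (simp add: iC)
  moreover have "(c, z) \<in> ?Q \<longleftrightarrow> (c, z) \<in> s \<or> (\<exists>c'\<in>C. (c, c') \<in> s) \<and> (\<exists>c\<in>C. (c, z) \<in> s)"
    if "c \<in> B" "c \<noteq> b" for c
    using y BC[OF that(1)] that(2) by (simp add: iC)
  ultimately show ?thesis unfolding Bex_def D using B(1) by blast
qed

text \<open>Every relation created by either of the two contractions passes through \<open>C\<close>
  or through the rest of \<open>B\<close>, hence through the composite block. The two preceding
  lemmas compare the relations to and from that block.\<close>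

lemma contract_contract_nested:
  assumes s: "s \<subseteq> P \<times> P" "\<forall>x\<in>P. (x, x) \<in> s" and C: "C \<noteq> {}" "C \<subseteq> P" and b: "b \<notin> P"
    and B: "b \<in> B" "B \<subseteq> insert b (P - C)" and a: "a \<notin> P" "a \<noteq> b"
  shows "contract B a (contract C b s) = contract (insert_at B b C) a s"
proof -
  let ?D = "insert_at B b C" and ?Q = "contract C b s"
  have DP: "?D \<subseteq> P" "?D \<noteq> {}" using C B by (auto simp: insert_at_def)
  have rC: "\<forall>c\<in>C. (c, c) \<in> s" and rD: "\<forall>d\<in>?D. (d, d) \<in> s" using s C DP by blast+
  have Q: "?Q \<subseteq> insert b (P - C) \<times> insert b (P - C)"
    by (rule contract_subset[OF s(1) rC C(1) b])
  have rB: "\<forall>b\<in>B. (b, b) \<in> ?Q" and Bne: "B \<noteq> {}"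
    using contract_refl[OF s C(1) b C(2)] B by blast+
  have aQ: "a \<notin> insert b (P - C)" using a by blast
  note iC = contract_iff[OF s(1) rC C(1) b] and iB = contract_iff[OF Q rB Bne aQ]
    and iD = contract_iff[OF s(1) rD DP(2) a(1)]
  have D: "x \<in> ?D \<longleftrightarrow> x \<in> B \<and> x \<noteq> b \<or> x \<in> C" for x
    using B C b by (auto simp: insert_at_def)
  note down = contract_below_iff[OF assms(1-7)] and up = contract_above_iff[OF assms(1-7)]
  have eq: "insert b (P - C) - B = P - ?D"
    using B C b by (auto simp: insert_at_def)
  have "contract B a ?Q \<subseteq> insert a (P - ?D) \<times> insert a (P - ?D)"
    using contract_subset[OF Q rB Bne aQ] unfolding eq .
  moreover have "contract ?D a s \<subseteq> insert a (P - ?D) \<times> insert a (P - ?D)"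
    by (rule contract_subset[OF s(1) rD DP(2) a(1)])
  moreover have "(x, y) \<in> contract B a ?Q \<longleftrightarrow> (x, y) \<in> contract ?D a s"
    if xy: "x \<in> insert a (P - ?D)" "y \<in> insert a (P - ?D)" for x y
  proof -
    have *: "z \<notin> B" "z \<notin> C" "z \<noteq> b" "z \<noteq> a" if "z \<in> P - ?D" for z
      using that D a b by auto
    have Qxy: "(x, y) \<in> ?Q \<longleftrightarrow> (x, y) \<in> s \<or> (\<exists>c\<in>C. (x, c) \<in> s) \<and> (\<exists>c\<in>C. (c, y) \<in> s)"
      if "x \<in> P - ?D" "y \<in> P - ?D"
      using *[OF that(1)] *[OF that(2)] by (simp add: iC)
    consider "x = a" "y = a" | "x = a" "y \<in> P - ?D" | "x \<in> P - ?D" "y = a"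
      | "x \<in> P - ?D" "y \<in> P - ?D" using xy by blast
    then show ?thesis
    proof cases
      case 1
      then show ?thesis by (simp add: iB iD)
    next
      case 2
      then show ?thesis using *[OF 2(2)] up[OF 2(2)] by (simp add: iB iD)
    next
      case 3
      then show ?thesis using *[OF 3(1)] down[OF 3(1)] by (simp add: iB iD)
    next
      case 4
      then have "(x, y) \<in> contract B a ?Q \<longleftrightarrow>
          (x, y) \<in> ?Q \<or> (\<exists>c\<in>?D. (x, c) \<in> s) \<and> (\<exists>c\<in>?D. (c, y) \<in> s)"
        using *[OF 4(1)] *[OF 4(2)] down[OF 4(1)] up[OF 4(2)] by (simp add: iB)
      \<comment> \<open>The relations that \<open>?Q\<close> adds through \<open>C\<close> are
        absorbed, because \<open>C\<close> is contained in \<open>?D\<close>.\<close>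
      also have "\<dots> \<longleftrightarrow> (x, y) \<in> s \<or> (\<exists>c\<in>?D. (x, c) \<in> s) \<and> (\<exists>c\<in>?D. (c, y) \<in> s)"
        unfolding Qxy[OF 4] Bex_def D by blast
      also have "\<dots> \<longleftrightarrow> (x, y) \<in> contract ?D a s"
        using *[OF 4(1)] *[OF 4(2)] 4 by (simp add: iD)
      finally show ?thesis .
    qed
  qed
  ultimately show ?thesis by (rule rel_eqI)
qed

text \<open>Both double contractions are described by the same conditions: which outside points lie
  below or above each block, and whether the blocks are related in either direction. The hypotheses
  are symmetric in the two blocks, so one inclusion gives equality.\<close>

lemma contract_contract_subset:
  assumes s: "s \<subseteq> P \<times> P" "\<forall>x\<in>P. (x, x) \<in> s"
    and C: "C \<noteq> {}" "C \<subseteq> P" "c \<notin> P" and B: "B \<noteq> {}" "B \<subseteq> P" "a \<notin> P"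
    and d: "B \<inter> C = {}" "a \<noteq> c"
  shows "contract B a (contract C c s) \<subseteq> contract C c (contract B a s)"
proof -
  let ?Q = "contract C c s" and ?R = "contract B a s"
  have rC: "\<forall>c\<in>C. (c, c) \<in> s" and rB: "\<forall>b\<in>B. (b, b) \<in> s" using s C B by blast+
  have Q: "?Q \<subseteq> insert c (P - C) \<times> insert c (P - C)" and R: "?R \<subseteq> insert a (P - B) \<times> insert a (P - B)"
    by (rule contract_subset[OF s(1) rC C(1,3)], rule contract_subset[OF s(1) rB B(1,3)])
  have rBQ: "\<forall>b\<in>B. (b, b) \<in> ?Q" and rCR: "\<forall>c\<in>C. (c, c) \<in> ?R"
    using contract_refl[OF s C(1,3,2)] contract_refl[OF s B(1,3,2)] B C d by blast+
  have aQ: "a \<notin> insert c (P - C)" and cR: "c \<notin> insert a (P - B)" using B C d by blast+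
  \<comment> \<open>These predicates describe the down-sets and up-sets of the blocks; with the
    truth values \<open>BC\<close> and \<open>CB\<close> they express all relations that involve a
    block in either quotient.\<close>
  define dB where "dB x = (\<exists>u\<in>B. (x, u) \<in> s)" for x
  define dC where "dC x = (\<exists>u\<in>C. (x, u) \<in> s)" for x
  define uB where "uB x = (\<exists>u\<in>B. (u, x) \<in> s)" for x
  define uC where "uC x = (\<exists>u\<in>C. (u, x) \<in> s)" for x
  define BC where "BC = (\<exists>u\<in>B. \<exists>v\<in>C. (u, v) \<in> s)"
  define CB where "CB = (\<exists>u\<in>C. \<exists>v\<in>B. (u, v) \<in> s)"
  note iQ = contract_iff[OF s(1) rC C(1,3), folded dC_def uC_def]
    and iR = contract_iff[OF s(1) rB B(1,3), folded dB_def uB_def]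
    and iL = contract_iff[OF Q rBQ B(1) aQ] and iM = contract_iff[OF R rCR C(1) cR]
  \<comment> \<open>Both double contractions live on \<open>N\<close> together with the two points
    \<open>a\<close> and \<open>c\<close>, which leads to nine cases for a pair.\<close>
  define N where "N = P - B - C"
  have N: "z \<notin> B" "z \<notin> C" "z \<noteq> a" "z \<noteq> c" if "z \<in> N" for z
    using that B C unfolding N_def by auto
  have nB: "z \<notin> C" "z \<noteq> a" "z \<noteq> c" if "z \<in> B" for z
    using that B C d by auto
  have nC: "z \<notin> B" "z \<noteq> a" "z \<noteq> c" if "z \<in> C" for z
    using that B C d by auto
  \<comment> \<open>In the quotient by \<open>C\<close>, an outside point reaches \<open>B\<close>
    directly or by a detour through \<open>C\<close>; the detour exists only if \<open>C\<close>
    itself reaches \<open>B\<close>. \<open>Q1\<close> to \<open>Q4\<close> record such conditions,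
    and \<open>R1\<close> to \<open>R4\<close> are their counterparts with the blocks
    exchanged.\<close>
  have "(\<exists>u\<in>B. (z, u) \<in> ?Q) \<longleftrightarrow> (\<exists>u\<in>B. (z, u) \<in> s \<or> dC z \<and> uC u)" if "z \<in> N" for z
    by (rule bex_cong) (use N[OF that] nB in \<open>simp_all add: iQ\<close>)
  then have Q1: "(\<exists>u\<in>B. (z, u) \<in> ?Q) \<longleftrightarrow> dB z \<or> dC z \<and> CB" if "z \<in> N" for z
    using that unfolding dB_def dC_def uC_def CB_def by blast
  have "(\<exists>u\<in>B. (u, z) \<in> ?Q) \<longleftrightarrow> (\<exists>u\<in>B. (u, z) \<in> s \<or> dC u \<and> uC z)" if "z \<in> N" for z
    by (rule bex_cong) (use N[OF that] nB in \<open>simp_all add: iQ\<close>)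
  then have Q2: "(\<exists>u\<in>B. (u, z) \<in> ?Q) \<longleftrightarrow> uB z \<or> BC \<and> uC z" if "z \<in> N" for z
    using that unfolding uB_def dC_def uC_def BC_def by blast
  have "(\<exists>u\<in>B. (c, u) \<in> ?Q) \<longleftrightarrow> (\<exists>u\<in>B. uC u)"
    by (rule bex_cong) (use nB in \<open>simp_all add: iQ\<close>)
  then have Q3: "(\<exists>u\<in>B. (c, u) \<in> ?Q) \<longleftrightarrow> CB"
    unfolding uC_def CB_def by blast
  have "(\<exists>u\<in>B. (u, c) \<in> ?Q) \<longleftrightarrow> (\<exists>u\<in>B. dC u)"
    by (rule bex_cong) (use nB in \<open>simp_all add: iQ\<close>)
  then have Q4: "(\<exists>u\<in>B. (u, c) \<in> ?Q) \<longleftrightarrow> BC"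
    unfolding dC_def BC_def by blast
  have "(\<exists>u\<in>C. (z, u) \<in> ?R) \<longleftrightarrow> (\<exists>u\<in>C. (z, u) \<in> s \<or> dB z \<and> uB u)" if "z \<in> N" for z
    by (rule bex_cong) (use N[OF that] nC in \<open>simp_all add: iR\<close>)
  then have R1: "(\<exists>u\<in>C. (z, u) \<in> ?R) \<longleftrightarrow> dC z \<or> dB z \<and> BC" if "z \<in> N" for z
    using that unfolding dB_def dC_def uB_def BC_def by blast
  have "(\<exists>u\<in>C. (u, z) \<in> ?R) \<longleftrightarrow> (\<exists>u\<in>C. (u, z) \<in> s \<or> dB u \<and> uB z)" if "z \<in> N" for z
    by (rule bex_cong) (use N[OF that] nC in \<open>simp_all add: iR\<close>)
  then have R2: "(\<exists>u\<in>C. (u, z) \<in> ?R) \<longleftrightarrow> uC z \<or> CB \<and> uB z" if "z \<in> N" for z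
    using that unfolding uB_def dB_def uC_def CB_def by blast
  have "(\<exists>u\<in>C. (a, u) \<in> ?R) \<longleftrightarrow> (\<exists>u\<in>C. uB u)"
    by (rule bex_cong) (use nC in \<open>simp_all add: iR\<close>)
  then have R3: "(\<exists>u\<in>C. (a, u) \<in> ?R) \<longleftrightarrow> BC"
    unfolding uB_def BC_def by blast
  have "(\<exists>u\<in>C. (u, a) \<in> ?R) \<longleftrightarrow> (\<exists>u\<in>C. dB u)"
    by (rule bex_cong) (use nC in \<open>simp_all add: iR\<close>)
  then have R4: "(\<exists>u\<in>C. (u, a) \<in> ?R) \<longleftrightarrow> CB"
    unfolding dB_def CB_def by blast
  have aN: "(a, z) \<in> ?R \<longleftrightarrow> uB z" "(z, a) \<in> ?R \<longleftrightarrow> dB z"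
    and cN: "(c, z) \<in> ?Q \<longleftrightarrow> uC z" "(z, c) \<in> ?Q \<longleftrightarrow> dC z" if "z \<in> N" for z
    using N[OF that] by (simp_all add: iQ iR)
  have NN: "(z, w) \<in> ?R \<longleftrightarrow> (z, w) \<in> s \<or> dB z \<and> uB w"
    "(z, w) \<in> ?Q \<longleftrightarrow> (z, w) \<in> s \<or> dC z \<and> uC w" if "z \<in> N" "w \<in> N" for z w
    using N[OF that(1)] N[OF that(2)] by (simp_all add: iQ iR)
  have cB: "c \<notin> B" "a \<notin> C" "a \<notin> B" "c \<notin> C" using B C by auto
  show ?thesis
  proof clarify
    fix x y assume xy: "(x, y) \<in> contract B a ?Q"
    then have "x \<in> {a, c} \<union> N \<and> y \<in> {a, c} \<union> N"
      using contract_subset[OF Q rBQ B(1) aQ] unfolding N_def by blast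
    then consider "x = a" "y = a" | "x = a" "y = c" | "x = a" "y \<in> N"
      | "x = c" "y = a" | "x = c" "y = c" | "x = c" "y \<in> N"
      | "x \<in> N" "y = a" | "x \<in> N" "y = c" | "x \<in> N" "y \<in> N" by blast
    then show "(x, y) \<in> contract C c ?R"
    proof cases
      case 1
      then show ?thesis using xy d(2) cB
        by (auto simp: iL iM Q3 Q4 R3 R4 iR)
    next
      case 2
      then show ?thesis using xy d(2) cB
        by (auto simp: iL iM Q3 Q4 R3 R4 )
    next
      case 3
      then show ?thesis using xy d(2) cB N[OF 3(2)] Q2[OF 3(2)] R2[OF 3(2)]
        by (auto simp: iL iM Q3 Q4 R3 R4 aN)
    next
      case 4
      then show ?thesis using xy d(2) cB
        by (auto simp: iL iM Q3 Q4 R3 R4 )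
    next
      case 5
      then show ?thesis using xy d(2) cB
        by (auto simp: iL iM Q3 Q4 R3 R4 iQ)
    next
      case 6
      then show ?thesis using xy d(2) cB N[OF 6(2)] Q2[OF 6(2)] R2[OF 6(2)]
        by (auto simp: iL iM Q3 Q4 R3 R4 cN)
    next
      case 7
      then show ?thesis using xy d(2) cB N[OF 7(1)] Q1[OF 7(1)] R1[OF 7(1)]
        by (auto simp: iL iM Q3 Q4 R3 R4 aN)
    next
      case 8
      then show ?thesis using xy d(2) cB N[OF 8(1)] Q1[OF 8(1)] R1[OF 8(1)]
        by (auto simp: iL iM Q3 Q4 R3 R4 cN)
    next
      case 9
      then show ?thesis using xy d(2) cB N[OF 9(1)] Q1[OF 9(1)] R1[OF 9(1)] N[OF 9(2)] Q2[OF 9(2)] R2[OF 9(2)]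
        by (auto simp: iL iM Q3 Q4 R3 R4 NN)
    qed
  qed
qed

lemma contract_contract_commute:
  assumes "s \<subseteq> P \<times> P" "\<forall>x\<in>P. (x, x) \<in> s"
    and "C \<noteq> {}" "C \<subseteq> P" "c \<notin> P" and "B \<noteq> {}" "B \<subseteq> P" "a \<notin> P"
    and "B \<inter> C = {}" "a \<noteq> c"
  shows "contract B a (contract C c s) = contract C c (contract B a s)"
  using assms by (intro equalityI contract_contract_subset[of s P]) auto

section \<open>Associativity, units and naturality for \<open>\<Omega>\<close>\<close>

lemma partial_order_onD:
  assumes "partial_order_on A r"
  shows "r \<subseteq> A \<times> A" "\<forall>x\<in>A. (x, x) \<in> r"
    "\<And>x y z. (x, y) \<in> r \<Longrightarrow> (y, z) \<in> r \<Longrightarrow> (x, z) \<in> r" "\<And>x y. (x, y) \<in> r \<Longrightarrow> (y, x) \<in> r \<Longrightarrow> x = y"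
  using assms unfolding partial_order_on_iff by (meson+)

lemma partial_order_on_Restr:
  "partial_order_on A r \<Longrightarrow> B \<subseteq> A \<Longrightarrow> partial_order_on B (Restr r B)"
  unfolding partial_order_on_iff by blast

lemma partial_order_on_image:
  assumes "partial_order_on A r" "inj_on f A"
  shows "partial_order_on (f ` A) (map_prod f f ` r)"
proof -
  note r = partial_order_onD[OF assms(1)]
  have inj: "x = y" if "f x = f y" "x \<in> A" "y \<in> A" for x y
    using assms(2) that by (auto dest: inj_onD)
  show ?thesis
    unfolding partial_order_on_iff
  proof (intro conjI allI impI)
    show "(x, z) \<in> map_prod f f ` r"
      if "(x, y) \<in> map_prod f f ` r" "(y, z) \<in> map_prod f f ` r" for x y z
      using that unfolding map_prod_image_iff using inj r(1,3) by (metis mem_Sigma_iff subsetD)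
    show "x = y" if "(x, y) \<in> map_prod f f ` r" "(y, x) \<in> map_prod f f ` r" for x y
      using that unfolding map_prod_image_iff using inj r(1,4) by (metis mem_Sigma_iff subsetD)
  qed (use r(1,2) in auto)
qed

text \<open>Convexity as the absence of an outside point both above and below the block. The two
  existential statements are separated so that \<open>contract_below_iff\<close> and
  \<open>contract_above_iff\<close> can be substituted.\<close>

lemma poset_convex_iff:
  assumes "r \<subseteq> P \<times> P"
  shows "poset_convex P r B \<longleftrightarrow>
    B \<subseteq> P \<and> (\<forall>z\<in>P - B. \<not> ((\<exists>x\<in>B. (x, z) \<in> r) \<and> (\<exists>y\<in>B. (z, y) \<in> r)))"
  unfolding poset_convex_def by blast

text \<open>Restriction and contraction commute because the block lies inside \<open>D\<close>: the
  intermediate points that create new relations survive the restriction.\<close>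

lemma contract_Restr:
  assumes s: "s \<subseteq> P \<times> P" "\<forall>x\<in>P. (x, x) \<in> s" and C: "C \<noteq> {}" "C \<subseteq> D" "D \<subseteq> P" and b: "b \<notin> P"
  shows "contract C b (Restr s D) = Restr (contract C b s) (insert b (D - C))"
proof -
  have rC: "\<forall>c\<in>C. (c, c) \<in> s" "\<forall>c\<in>C. (c, c) \<in> Restr s D" and bD: "b \<notin> D" and sD: "Restr s D \<subseteq> D \<times> D"
    using assms by blast+
  note i1 = contract_iff[OF sD rC(2) C(1) bD] and i2 = contract_iff[OF s(1) rC(1) C(1) b]
  show ?thesis
  proof (rule rel_eqI)
    show "contract C b (Restr s D) \<subseteq> insert b (D - C) \<times> insert b (D - C)"
      by (rule contract_subset[OF sD rC(2) C(1) bD])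
    show "(x, y) \<in> contract C b (Restr s D) \<longleftrightarrow> (x, y) \<in> Restr (contract C b s) (insert b (D - C))"
      if "x \<in> insert b (D - C)" "y \<in> insert b (D - C)" for x y
      using that C(2) bD unfolding Int_iff i1 i2 by (cases "x = b"; cases "y = b"; simp; blast)
  qed blast
qed

section \<open>Associativity of the sets \<open>Omega\<close>\<close>

text \<open>The new intermediate order is \<open>contract B a s\<close>. Exchanging the two
  insertions permutes the hypotheses, so the reverse inclusion is another instance.\<close>

lemma Omega_parallel_subset:
  assumes AB: "A \<inter> B = {}" "A \<inter> C = {}" "B \<inter> C = {}" and ne: "B \<noteq> {}" "C \<noteq> {}"
    and a: "a \<in> A" "a' \<in> A" "a \<noteq> a'"
  shows "(\<Union>r\<in>Omega A rA a B rB. Omega (insert_at A a B) r a' C rC)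
    \<subseteq> (\<Union>r\<in>Omega A rA a' C rC. Omega (insert_at A a' C) r a B rB)"
proof clarify
  fix r s assume r: "r \<in> Omega A rA a B rB" and s: "s \<in> Omega (insert_at A a B) r a' C rC"
  let ?A1 = "insert_at A a B" and ?A2 = "insert_at A a' C"
  define P where "P = insert_at ?A1 a' C"
  have sets: "a' \<in> ?A1" "?A1 \<inter> C = {}" "a \<in> ?A2" "?A2 \<inter> B = {}" "insert_at ?A2 a B = P"
    "B \<subseteq> P" "C \<subseteq> P" "a \<notin> P" "a' \<notin> P" "?A1 = insert a' (P - C)" "?A2 = insert a (P - B)"
    "a' \<notin> B" "a \<notin> C" "B \<subseteq> ?A1" "C \<subseteq> ?A2"
    using assms unfolding P_def insert_at_def by auto
  have r': "partial_order_on ?A1 r" "Restr r B = rB" "poset_convex ?A1 r B" "contract B a r = rA"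
    using r by (simp_all add: Omega_iff AB ne a)
  have s': "partial_order_on P s" "Restr s C = rC" "poset_convex P s C" "contract C a' s = r"
    using s unfolding Omega_iff[OF sets(1,2) ne(2)] P_def by blast+
  note po = partial_order_onD[OF s'(1)]
  have rfl: "\<forall>x\<in>B. (x, x) \<in> s" "\<forall>x\<in>C. (x, x) \<in> s" using po sets by blast+
  note ir = contract_iff[OF po(1) rfl(2) ne(2) sets(9), unfolded s'(4)]
  let ?r = "contract B a s"
  note ir' = contract_iff[OF po(1) rfl(1) ne(1) sets(8)]
  have cvr: "z \<in> B" if "x \<in> B" "y \<in> B" "(x, z) \<in> r" "(z, y) \<in> r" for x y z
    using r'(3) partial_order_onD(1)[OF r'(1)] that unfolding poset_convex_def by blast
  have BC: "z \<noteq> a'" "z \<notin> C" if "z \<in> B" for z using that AB sets by auto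
  \<comment> \<open>Otherwise the contracted point \<open>a'\<close> would lie between
    \<open>x\<close> and \<open>y\<close> in \<open>r\<close>, against the convexity of
    \<open>B\<close> in \<open>r\<close>, since \<open>a'\<close> is not in
    \<open>B\<close>.\<close>
  have K: "\<not> ((\<exists>c\<in>C. (x, c) \<in> s) \<and> (\<exists>c\<in>C. (c, y) \<in> s))" if "x \<in> B" "y \<in> B" for x y
    using cvr[OF that, of a'] BC[OF that(1)] BC[OF that(2)] sets(12) by (auto simp: ir)
  \<comment> \<open>The same obstruction seen from \<open>C\<close>: relations in both directions
    between the blocks cannot coexist.\<close>
  have K': "\<not> ((\<exists>b\<in>B. (x, b) \<in> s) \<and> (\<exists>b\<in>B. (b, y) \<in> s))" if "x \<in> C" "y \<in> C" for x y
    using K that by blast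
  have rs: "(x, y) \<in> r" if "(x, y) \<in> s" "x \<notin> C" "y \<notin> C" for x y
  proof -
    have "x \<noteq> a'" "y \<noteq> a'" using that(1) po(1) sets(9) by blast+
    then show ?thesis using that by (simp add: ir)
  qed
  have cvB: "poset_convex P s B"
    unfolding poset_convex_def
  proof (intro conjI ballI impI; (elim conjE)?)
    fix x y z assume z: "x \<in> B" "y \<in> B" "z \<in> P" "(x, z) \<in> s" "(z, y) \<in> s"
    \<comment> \<open>A point \<open>z\<close> of \<open>C\<close> would lie above \<open>x\<close>
      and below \<open>y\<close>. Outside \<open>C\<close> the two relations persist in
      \<open>r\<close>, where \<open>B\<close> is convex.\<close>
    then have "z \<notin> C" using K by blast
    then show "z \<in> B" using cvr[of x y z] z rs BC by blast
  qed (rule sets)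
  have rB: "Restr s B = rB"
  proof -
    have "(x, y) \<in> s \<longleftrightarrow> (x, y) \<in> r" if "x \<in> B" "y \<in> B" for x y
      using K[OF that] BC[OF that(1)] BC[OF that(2)] by (auto simp: ir)
    then show ?thesis using r'(2) by blast
  qed
  have CB: "z \<noteq> a" "z \<notin> B" if "z \<in> C" for z using that AB sets by auto
  have rC: "Restr ?r C = rC"
  proof -
    have "(x, y) \<in> ?r \<longleftrightarrow> (x, y) \<in> s" if "x \<in> C" "y \<in> C" for x y
      using K'[OF that] CB[OF that(1)] CB[OF that(2)] by (auto simp: ir')
    then show ?thesis using s'(2) by blast
  qed
  have por: "partial_order_on ?A2 ?r"
    unfolding sets(11) by (rule partial_order_on_contract[OF s'(1) cvB ne(1) sets(8)])
  have cvs: "z \<in> C" if "x \<in> C" "y \<in> C" "(x, z) \<in> s" "(z, y) \<in> s" for x y z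
    using s'(3) po(1) that unfolding poset_convex_def by blast
  have cvC: "poset_convex ?A2 ?r C"
    unfolding poset_convex_def
  proof (intro conjI ballI impI; (elim conjE)?)
    fix x y z assume z: "x \<in> C" "y \<in> C" "z \<in> ?A2" "(x, z) \<in> ?r" "(z, y) \<in> ?r"
    have "z \<noteq> a"
      using z K'[OF z(1,2)] CB[OF z(1)] CB[OF z(2)] by (auto simp: ir')
    then have zB: "z \<notin> B" and "(x, z) \<in> s \<or> (\<exists>b\<in>B. (x, b) \<in> s) \<and> (\<exists>b\<in>B. (b, z) \<in> s)"
      "(z, y) \<in> s \<or> (\<exists>b\<in>B. (z, b) \<in> s) \<and> (\<exists>b\<in>B. (b, y) \<in> s)"
      using z CB[OF z(1)] CB[OF z(2)] by (auto simp: ir')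
    \<comment> \<open>If either relation passed through \<open>B\<close>, then \<open>x\<close>
      would lie below a point of \<open>B\<close> and \<open>y\<close> above one, which
      \<open>K'\<close> excludes.\<close>
    then have "(x, z) \<in> s" "(z, y) \<in> s"
      using K'[OF z(1,2)] po(3) by meson+
    then show "z \<in> C" using cvs z by blast
  qed (rule sets)
  have "contract C a' ?r = rA"
    unfolding r'(4)[symmetric] s'(4)[symmetric]
    by (rule contract_contract_commute[OF po(1,2)]) (use sets ne AB a in auto)
  then have "?r \<in> Omega A rA a' C rC"
    using por rC cvC by (simp add: Omega_iff AB ne a)
  moreover have "s \<in> Omega ?A2 ?r a B rB"
    unfolding Omega_iff[OF sets(3,4) ne(1)] sets(5) using s'(1) rB cvB by blast
  ultimately show "s \<in> (\<Union>r\<in>Omega A rA a' C rC. Omega ?A2 r a B rB)" by blast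
qed

lemma Omega_parallel:
  assumes "A \<inter> B = {}" "A \<inter> C = {}" "B \<inter> C = {}" "B \<noteq> {}" "C \<noteq> {}"
    and "a \<in> A" "a' \<in> A" "a \<noteq> a'"
  shows "(\<Union>r\<in>Omega A rA a B rB. Omega (insert_at A a B) r a' C rC)
    = (\<Union>r\<in>Omega A rA a' C rC. Omega (insert_at A a' C) r a B rB)"
  by (intro equalityI Omega_parallel_subset) (use assms in auto)

text \<open>Each side forces \<open>s\<close> to be a partial order in which \<open>C\<close> is
  convex. For such \<open>s\<close> the intermediate order is unique on each side, and the remaining
  conditions are matched one by one.\<close>

lemma Omega_nested:
  assumes AB: "A \<inter> B = {}" "A \<inter> C = {}" "B \<inter> C = {}" and ne: "C \<noteq> {}"
    and a: "a \<in> A" "b \<in> B"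
  shows "(\<Union>r\<in>Omega A rA a B rB. Omega (insert_at A a B) r b C rC)
    = (\<Union>r\<in>Omega B rB b C rC. Omega A rA a (insert_at B b C) r)"
proof -
  let ?A1 = "insert_at A a B" and ?D = "insert_at B b C"
  define P where "P = insert_at ?A1 b C"
  have sets: "b \<in> ?A1" "?A1 \<inter> C = {}" "A \<inter> ?D = {}" "?D \<noteq> {}" "insert_at A a ?D = P"
    "?D \<subseteq> P" "C \<subseteq> P" "C \<subseteq> ?D" "a \<notin> P" "b \<notin> P" "?A1 = insert b (P - C)" "B = insert b (?D - C)"
    "B \<subseteq> ?A1" "B \<noteq> {}" "B \<subseteq> insert b (P - C)" "a \<noteq> b"
    using assms unfolding P_def insert_at_def by auto
  have "(\<exists>r. r \<in> Omega A rA a B rB \<and> s \<in> Omega ?A1 r b C rC) \<longleftrightarrow>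
      (\<exists>r. r \<in> Omega B rB b C rC \<and> s \<in> Omega A rA a ?D r)" for s
  proof (cases "partial_order_on P s \<and> poset_convex P s C")
    case True
    then have s: "partial_order_on P s" "poset_convex P s C" by auto
    note po = partial_order_onD[OF s(1)]
    let ?q = "contract C b s" and ?t = "Restr s ?D"
    have rfl: "\<forall>x\<in>C. (x, x) \<in> s" using po(2) sets by blast
    note iq = contract_iff[OF po(1) rfl ne sets(10)]
    have poq: "partial_order_on ?A1 ?q"
      unfolding sets(11) by (rule partial_order_on_contract[OF s ne sets(10)])
    have pot: "partial_order_on ?D ?t" by (rule partial_order_on_Restr[OF s(1) sets(6)])
    have cvt: "poset_convex ?D ?t C"
      using s(2) sets(6,8) unfolding poset_convex_def by blast
    have rt: "contract C b ?t = Restr ?q B"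
      using contract_Restr[OF po(1,2) ne sets(8,6,10)] sets(12) by simp
    have qq: "contract B a ?q = contract ?D a s"
      by (rule contract_contract_nested[OF po(1,2) ne sets(7,10) a(2) sets(15,9,16)])
    have cv: "poset_convex ?A1 ?q B \<longleftrightarrow> poset_convex P s ?D"
    proof -
      \<comment> \<open>Both convexity conditions range over the same outside points, and lying
        below or above \<open>B\<close> in \<open>?q\<close> amounts to lying below or above
        \<open>?D\<close> in \<open>s\<close>.\<close>
      have "?A1 - B = P - ?D"
        using assms unfolding P_def insert_at_def by auto
      then show ?thesis
        unfolding poset_convex_iff[OF partial_order_onD(1)[OF poq]] poset_convex_iff[OF po(1)]
        using sets(6,13) contract_below_iff[OF po(1,2) ne sets(7,10) a(2) sets(15)]
          contract_above_iff[OF po(1,2) ne sets(7,10) a(2) sets(15)] by auto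
    qed
    have tC: "Restr ?t C = Restr s C" using sets(8) by blast
    \<comment> \<open>Here \<open>r\<close> can only be \<open>?q\<close>, and on the other side
      only \<open>?t\<close>, so each existential statement becomes a conjunction of conditions on
      \<open>s\<close>.\<close>
    have "(\<exists>r. r \<in> Omega A rA a B rB \<and> s \<in> Omega ?A1 r b C rC) \<longleftrightarrow>
      Restr ?q B = rB \<and> poset_convex ?A1 ?q B \<and> contract B a ?q = rA \<and> Restr s C = rC"
      using s poq by (auto simp: Omega_iff AB ne a sets(1,2,14) P_def[symmetric])
    also have "\<dots> \<longleftrightarrow> contract C b ?t = rB \<and> poset_convex P s ?D \<and> contract ?D a s = rA \<and> Restr ?t C = rC"
      unfolding rt qq cv tC ..
    also have "\<dots> \<longleftrightarrow> (\<exists>r. r \<in> Omega B rB b C rC \<and> s \<in> Omega A rA a ?D r)"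
      using s pot cvt by (auto simp: Omega_iff AB ne a sets(3,4,5))
    finally show ?thesis .
  next
    case False
    have "partial_order_on P s \<and> poset_convex P s C" if "r \<in> Omega A rA a B rB" "s \<in> Omega ?A1 r b C rC" for r
      using that by (auto simp: Omega_iff AB ne a sets(1,2,14) P_def[symmetric])
    moreover have "partial_order_on P s \<and> poset_convex P s C" if "r \<in> Omega B rB b C rC" "s \<in> Omega A rA a ?D r" for r
    proof -
      have r: "poset_convex ?D r C" using that(1) by (simp add: Omega_iff AB ne a)
      have s: "partial_order_on P s" "poset_convex P s ?D" "Restr s ?D = r"
        using that(2) by (simp_all add: Omega_iff a sets(3,4,5))
      \<comment> \<open>Convexity is transitive: a point between two points of \<open>C\<close> lies
        in \<open>?D\<close>, and then in \<open>C\<close> by convexity inside the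
        restriction.\<close>
      have "poset_convex P s C"
        using r s(2) sets(7,8) unfolding s(3)[symmetric] poset_convex_def by blast
      then show ?thesis using s(1) by blast
    qed
    ultimately show ?thesis using False by blast
  qed
  then show ?thesis by blast
qed

section \<open>Relabelling of relations and finiteness\<close>

lemma map_prod_image_id:
  assumes "r \<subseteq> A \<times> A" "\<And>x. x \<in> A \<Longrightarrow> f x = x"
  shows "map_prod f f ` r = r"
proof -
  have "map_prod f f p = id p" if "p \<in> r" for p
    using that assms by (cases p) auto
  then have "map_prod f f ` r = id ` r" by (rule image_cong[OF refl])
  then show ?thesis by simp
qed

lemma map_prod_image_cong:
  assumes "r \<subseteq> A \<times> A" "\<And>x. x \<in> A \<Longrightarrow> f x = g x"
  shows "map_prod f f ` r = map_prod g g ` r"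
proof (rule image_cong[OF refl])
  fix p assume "p \<in> r"
  then show "map_prod f f p = map_prod g g p" using assms by (cases p) auto
qed

lemma map_prod_image_comp: "map_prod f f ` map_prod g g ` r = map_prod (f \<circ> g) (f \<circ> g) ` r"
  by (simp add: image_comp map_prod.comp)

lemma map_prod_mem_iff:
  assumes "inj_on f A" "r \<subseteq> A \<times> A" "x \<in> A" "y \<in> A"
  shows "(f x, f y) \<in> map_prod f f ` r \<longleftrightarrow> (x, y) \<in> r"
proof
  assume "(f x, f y) \<in> map_prod f f ` r"
  then obtain u v where uv: "f x = f u" "f y = f v" "(u, v) \<in> r" by auto
  then have "u \<in> A" "v \<in> A" using assms(2) by blast+
  then have "x = u" "y = v" using uv(1,2) assms(3,4) by (auto intro: inj_onD[OF assms(1)])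
  then show "(x, y) \<in> r" using uv(3) by simp
qed auto

lemma partial_order_on_Omega: "r \<in> Omega A rA a B rB \<Longrightarrow> partial_order_on (insert_at A a B) r"
  by (simp add: Omega_def)

lemma Omega_subset: "Omega A rA a B rB \<subseteq> Pow (insert_at A a B \<times> insert_at A a B)"
  by (rule subsetI, rule PowI, rule partial_order_onD(1), rule partial_order_on_Omega)

text \<open>A sum over an infinite set is \<open>0\<close> by convention. Finiteness makes the sums
  of generators genuine and lets double sums be merged into sums over unions.\<close>

lemma finite_Omega:
  assumes "finite A" "finite B"
  shows "finite (Omega A rA a B rB)"
  by (rule finite_subset[OF Omega_subset]) (use assms in \<open>simp add: insert_at_def\<close>)

text \<open>By transitivity, passing through a single point creates no new relation, so only the
  renaming remains.\<close>

lemma contract_singleton: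
  assumes "partial_order_on P r" "b \<in> P"
  shows "contract {b} a r = map_prod (id(b := a)) (id(b := a)) ` r"
proof -
  have "r \<union> r O ({b} \<times> {b}) O r = r"
    using partial_order_onD(3)[OF assms(1)] by blast
  moreover have "(\<lambda>x. if x \<in> {b} then a else x) = id(b := a)"
    by auto
  ultimately show ?thesis
    unfolding contract_def Let_def by simp
qed

section \<open>Unit laws for the sets \<open>Omega\<close>\<close>

text \<open>The block is the whole carrier, so the restriction condition alone determines the
  order.\<close>

lemma Omega_unit_left:
  assumes B: "partial_order_on B rB" "B \<noteq> {}" "a \<notin> B"
  shows "Omega {a} {(a, a)} a B rB = {rB}"
proof -
  have i: "insert_at {a} a B = B" by (simp add: insert_at_def)
  note po = partial_order_onD[OF B(1)]
  have "contract B a rB = {(a, a)}"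
  proof (rule rel_eqI)
    have rfl: "\<forall>b\<in>B. (b, b) \<in> rB" using po(2) .
    show "contract B a rB \<subseteq> {a} \<times> {a}"
      using contract_subset[OF po(1) rfl B(2,3)] by simp
    show "(x, y) \<in> contract B a rB \<longleftrightarrow> (x, y) \<in> {(a, a)}" if "x \<in> {a}" "y \<in> {a}" for x y
      using that unfolding contract_iff[OF po(1) rfl B(2,3)] by simp
  qed simp
  moreover have "poset_convex B rB B" "Restr rB B = rB"
    using po(1) by (auto simp: poset_convex_def)
  ultimately have "rB \<in> Omega {a} {(a, a)} a B rB"
    using B by (simp add: Omega_iff i)
  moreover have "r = rB" if "r \<in> Omega {a} {(a, a)} a B rB" for r
  proof -
    have "partial_order_on B r" "Restr r B = rB"
      using that B by (simp_all add: Omega_iff i)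
    then show ?thesis using partial_order_onD(1) by blast
  qed
  ultimately show ?thesis by blast
qed

text \<open>Contracting a one-point block is an invertible relabelling, so the order is recovered
  from its quotient.\<close>

lemma Omega_unit_right:
  assumes A: "partial_order_on A rA" "a \<in> A" "b \<notin> A"
  shows "Omega A rA a {b} {(b, b)} = {map_prod (id(a := b)) (id(a := b)) ` rA}"
proof -
  let ?P = "insert_at A a {b}" and ?f = "id(a := b)" and ?g = "id(b := a)"
  have P: "?P = ?f ` A" "b \<in> ?P" "a \<notin> ?P"
    using A(2,3) by (auto simp: insert_at_def image_iff)
  have fg: "?f (?g x) = x" if "x \<in> ?P" for x using that P(3) by auto
  have gf: "?g (?f x) = x" if "x \<in> A" for x using that A(3) by auto
  have inj: "inj_on ?f A" using gf by (rule inj_on_inverseI)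
  have dis: "A \<inter> {b} = {}" "{b} \<noteq> {}" using A(3) by auto
  let ?r = "map_prod ?f ?f ` rA"
  have por: "partial_order_on ?P ?r"
    unfolding P(1) by (rule partial_order_on_image[OF A(1) inj])
  have cv: "poset_convex ?P r {b}" "Restr r {b} = {(b, b)}" if "partial_order_on ?P r" for r
    using partial_order_onD(2,4)[OF that] P(2) by (auto simp: poset_convex_def)
  have "contract {b} a ?r = rA"
    unfolding contract_singleton[OF por P(2)] map_prod_image_comp
    by (rule map_prod_image_id[OF partial_order_onD(1)[OF A(1)]]) (use gf in simp)
  then have "?r \<in> Omega A rA a {b} {(b, b)}"
    using por cv[OF por] unfolding Omega_iff[OF A(2) dis] by blast
  moreover have "r = ?r" if "r \<in> Omega A rA a {b} {(b, b)}" for r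
  proof -
    have r: "partial_order_on ?P r" "contract {b} a r = rA"
      using that unfolding Omega_iff[OF A(2) dis] by blast+
    show ?thesis
      unfolding r(2)[symmetric] contract_singleton[OF r(1) P(2)] map_prod_image_comp
      by (rule map_prod_image_id[OF partial_order_onD(1)[OF r(1)], symmetric]) (use fg in simp)
  qed
  ultimately show ?thesis by blast
qed

section \<open>Naturality under bijections\<close>

text \<open>Here \<open>\<rho>\<close> relabels the poset and \<open>\<sigma>\<close> its quotient.
  Collapsing the block and then applying \<open>\<sigma>\<close> is the same map on \<open>P\<close>
  as applying \<open>\<rho>\<close> and then collapsing the image of the block.\<close>

lemma contract_image:
  fixes \<rho> \<sigma> :: "'a \<Rightarrow> 'b"
  assumes r: "r \<subseteq> P \<times> P" and B: "B \<subseteq> P" and \<rho>: "inj_on \<rho> P"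
    and \<sigma>: "\<And>x. x \<in> P - B \<Longrightarrow> \<sigma> x = \<rho> x"
  shows "contract (\<rho> ` B) (\<sigma> a) (map_prod \<rho> \<rho> ` r) = map_prod \<sigma> \<sigma> ` contract B a r"
proof -
  let ?m = "\<lambda>f. image (map_prod f f)"
  let ?R = "r \<union> r O (B \<times> B) O r"
  let ?p = "\<lambda>x. if x \<in> B then a else x" and ?q = "\<lambda>x. if x \<in> \<rho> ` B then \<sigma> a else x"
  have R: "?R \<subseteq> P \<times> P" using r by blast
  have through: "(x, y) \<in> q O (S \<times> S) O q \<longleftrightarrow> (\<exists>b\<in>S. \<exists>b'\<in>S. (x, b) \<in> q \<and> (b', y) \<in> q)"
    for x y :: 'b and S q by blast
  have iff: "(\<rho> x, \<rho> y) \<in> ?m \<rho> r \<longleftrightarrow> (x, y) \<in> r" if "x \<in> P" "y \<in> P" for x y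
    by (rule map_prod_mem_iff[OF \<rho> r that])
  \<comment> \<open>Injectivity of \<open>\<rho>\<close> on \<open>P\<close> prevents relabelling
    from creating new composable pairs, so it commutes with adding the relations through the
    block.\<close>
  have "?m \<rho> r \<union> ?m \<rho> r O (\<rho> ` B \<times> \<rho> ` B) O ?m \<rho> r = ?m \<rho> ?R"
  proof (rule rel_eqI)
    show "?m \<rho> r \<union> ?m \<rho> r O (\<rho> ` B \<times> \<rho> ` B) O ?m \<rho> r \<subseteq> \<rho> ` P \<times> \<rho> ` P"
      using r by auto
    show "?m \<rho> ?R \<subseteq> \<rho> ` P \<times> \<rho> ` P"
      using R by auto
    fix x' y' assume "x' \<in> \<rho> ` P" "y' \<in> \<rho> ` P"
    then obtain x y where x: "x \<in> P" "x' = \<rho> x" and y: "y \<in> P" "y' = \<rho> y" by blast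
    have "(\<rho> x, \<rho> y) \<in> ?m \<rho> ?R \<longleftrightarrow> (x, y) \<in> ?R"
      by (rule map_prod_mem_iff[OF \<rho> R x(1) y(1)])
    also have "\<dots> \<longleftrightarrow> (x, y) \<in> r \<or> (\<exists>b\<in>B. \<exists>b'\<in>B. (x, b) \<in> r \<and> (b', y) \<in> r)"
      by blast
    also have "\<dots> \<longleftrightarrow> (\<rho> x, \<rho> y) \<in> ?m \<rho> r \<or>
        (\<exists>b\<in>B. \<exists>b'\<in>B. (\<rho> x, \<rho> b) \<in> ?m \<rho> r \<and> (\<rho> b', \<rho> y) \<in> ?m \<rho> r)"
      using iff x y B by (meson subsetD)
    also have "\<dots> \<longleftrightarrow> (\<rho> x, \<rho> y) \<in> ?m \<rho> r \<union> ?m \<rho> r O (\<rho> ` B \<times> \<rho> ` B) O ?m \<rho> r"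
      unfolding Un_iff through by simp
    finally show "(x', y') \<in> ?m \<rho> r \<union> ?m \<rho> r O (\<rho> ` B \<times> \<rho> ` B) O ?m \<rho> r \<longleftrightarrow> (x', y') \<in> ?m \<rho> ?R"
      using x y by simp
  qed
  then have "contract (\<rho> ` B) (\<sigma> a) (?m \<rho> r) = ?m (?q \<circ> \<rho>) ?R"
    unfolding contract_def Let_def by (simp only: map_prod_image_comp)
  also have "\<dots> = ?m (\<sigma> \<circ> ?p) ?R"
  proof (rule map_prod_image_cong[OF R])
    fix x assume "x \<in> P"
    then have "\<rho> x \<in> \<rho> ` B \<longleftrightarrow> x \<in> B" using B inj_on_image_mem_iff[OF \<rho>] by blast
    then show "(?q \<circ> \<rho>) x = (\<sigma> \<circ> ?p) x" using \<sigma> \<open>x \<in> P\<close> by auto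
  qed
  also have "\<dots> = ?m \<sigma> (contract B a r)"
    unfolding contract_def Let_def by (simp only: map_prod_image_comp)
  finally show ?thesis .
qed

lemma inj_on_glue:
  assumes "inj_on \<sigma> A" "inj_on \<tau> B" "\<sigma> ` A \<inter> \<tau> ` B = {}"
  shows "inj_on (\<lambda>x. if x \<in> B then \<tau> x else \<sigma> x) (insert_at A a B)"
proof (rule inj_onI)
  fix x y assume xy: "x \<in> insert_at A a B" "y \<in> insert_at A a B"
    and eq: "(if x \<in> B then \<tau> x else \<sigma> x) = (if y \<in> B then \<tau> y else \<sigma> y)"
  have A: "z \<in> A" if "z \<in> insert_at A a B" "z \<notin> B" for z
    using that by (simp add: insert_at_def)
  have ne: "\<tau> u \<noteq> \<sigma> v" if "u \<in> B" "v \<in> A" for u v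
    using assms(3) that by blast
  show "x = y"
    using eq A[OF xy(1)] A[OF xy(2)] ne[of x y] ne[of y x]
      inj_onD[OF assms(1), of x y] inj_onD[OF assms(2), of x y]
    by (cases "x \<in> B"; cases "y \<in> B") auto
qed

lemma Omega_image:
  assumes AB: "A \<inter> B = {}" "B \<noteq> {}" "a \<in> A"
    and inj: "inj_on \<sigma> A" "inj_on \<tau> B" "\<sigma> ` A \<inter> \<tau> ` B = {}"
    and r: "r \<in> Omega A rA a B rB"
  defines "\<rho> \<equiv> \<lambda>x. if x \<in> B then \<tau> x else \<sigma> x"
  shows "map_prod \<rho> \<rho> ` r
    \<in> Omega (\<sigma> ` A) (map_prod \<sigma> \<sigma> ` rA) (\<sigma> a) (\<tau> ` B) (map_prod \<tau> \<tau> ` rB)"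
proof -
  let ?P = "insert_at A a B"
  have r: "partial_order_on ?P r" "Restr r B = rB" "poset_convex ?P r B" "contract B a r = rA"
    using r unfolding Omega_iff[OF AB(3,1,2)] by blast+
  note po = partial_order_onD[OF r(1)]
  have \<rho>: "inj_on \<rho> ?P" unfolding \<rho>_def by (rule inj_on_glue[OF inj])
  have B: "B \<subseteq> ?P" by (simp add: insert_at_def)
  have \<rho>B: "\<rho> ` B = \<tau> ` B" by (simp add: \<rho>_def)
  have "\<sigma> ` (A - {a}) = \<sigma> ` A - {\<sigma> a}"
    using inj_on_image_set_diff[OF inj(1), of A "{a}"] AB(3) by simp
  moreover have "\<rho> ` (A - {a}) = \<sigma> ` (A - {a})"
    using AB(1) by (intro image_cong) (auto simp: \<rho>_def)
  ultimately have \<rho>P: "\<rho> ` ?P = insert_at (\<sigma> ` A) (\<sigma> a) (\<tau> ` B)"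
    by (simp add: insert_at_def image_Un \<rho>B)
  have iff: "(\<rho> x, \<rho> y) \<in> map_prod \<rho> \<rho> ` r \<longleftrightarrow> (x, y) \<in> r" if "x \<in> ?P" "y \<in> ?P" for x y
    by (rule map_prod_mem_iff[OF \<rho> po(1) that])
  have "partial_order_on (\<rho> ` ?P) (map_prod \<rho> \<rho> ` r)"
    by (rule partial_order_on_image[OF r(1) \<rho>])
  moreover have "Restr (map_prod \<rho> \<rho> ` r) (\<rho> ` B) = map_prod \<tau> \<tau> ` rB"
  proof -
    have "map_prod \<tau> \<tau> ` rB = map_prod \<rho> \<rho> ` Restr r B"
      unfolding r(2)
      by (rule map_prod_image_cong[of _ B]) (use r(2) in \<open>auto simp: \<rho>_def\<close>)
    moreover have "Restr (map_prod \<rho> \<rho> ` r) (\<rho> ` B) = map_prod \<rho> \<rho> ` Restr r B"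
    proof (rule rel_eqI[of _ "\<rho> ` B"])
      fix x y assume "x \<in> \<rho> ` B" "y \<in> \<rho> ` B"
      then obtain u v where uv: "u \<in> B" "v \<in> B" "x = \<rho> u" "y = \<rho> v" by blast
      have "(\<rho> u, \<rho> v) \<in> map_prod \<rho> \<rho> ` r \<longleftrightarrow> (u, v) \<in> r"
        by (rule iff) (use uv B in auto)
      moreover have "(\<rho> u, \<rho> v) \<in> map_prod \<rho> \<rho> ` Restr r B \<longleftrightarrow> (u, v) \<in> Restr r B"
        by (rule map_prod_mem_iff[OF inj_on_subset[OF \<rho> B]]) (use uv in auto)
      ultimately show "(x, y) \<in> Restr (map_prod \<rho> \<rho> ` r) (\<rho> ` B) \<longleftrightarrow> (x, y) \<in> map_prod \<rho> \<rho> ` Restr r B"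
        using uv by simp
    qed auto
    ultimately show ?thesis by simp
  qed
  moreover have "poset_convex (\<rho> ` ?P) (map_prod \<rho> \<rho> ` r) (\<rho> ` B)"
    unfolding poset_convex_def
  proof (intro conjI ballI impI; (elim conjE)?)
    fix x y z
    assume "x \<in> \<rho> ` B" "y \<in> \<rho> ` B" "z \<in> \<rho> ` ?P"
    then obtain u v w where uvw: "x = \<rho> u" "y = \<rho> v" "z = \<rho> w" "u \<in> B" "v \<in> B" "w \<in> ?P"
      by blast
    assume "(x, z) \<in> map_prod \<rho> \<rho> ` r" "(z, y) \<in> map_prod \<rho> \<rho> ` r"
    then have "(u, w) \<in> r" "(w, v) \<in> r"
      using iff[of u w] iff[of w v] B uvw by auto
    then have "w \<in> B" using r(3) uvw unfolding poset_convex_def by blast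
    then show "z \<in> \<rho> ` B" using uvw by blast
  qed (use B in blast)
  moreover have "contract (\<rho> ` B) (\<sigma> a) (map_prod \<rho> \<rho> ` r) = map_prod \<sigma> \<sigma> ` rA"
    unfolding r(4)[symmetric] by (rule contract_image[OF po(1) B \<rho>]) (simp add: \<rho>_def)
  moreover have "\<sigma> a \<in> \<sigma> ` A" "\<tau> ` B \<noteq> {}" using AB by auto
  ultimately show ?thesis
    using inj(3) by (simp add: Omega_iff \<rho>P \<rho>B)
qed

text \<open>\<open>Omega_image\<close> gives one inclusion; the other is the same lemma applied to
  the inverse bijections.\<close>

lemma Omega_natural:
  assumes AB: "A \<inter> B = {}" "B \<noteq> {}" "a \<in> A"
    and inj: "inj_on \<sigma> A" "inj_on \<tau> B" "\<sigma> ` A \<inter> \<tau> ` B = {}"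
    and rA: "rA \<subseteq> A \<times> A" and rB: "rB \<subseteq> B \<times> B"
  defines "\<rho> \<equiv> \<lambda>x. if x \<in> B then \<tau> x else \<sigma> x"
  shows "Omega (\<sigma> ` A) (map_prod \<sigma> \<sigma> ` rA) (\<sigma> a) (\<tau> ` B) (map_prod \<tau> \<tau> ` rB)
    = image (map_prod \<rho> \<rho>) ` Omega A rA a B rB"
proof (intro equalityI subsetI)
  let ?\<sigma> = "inv_into A \<sigma>" and ?\<tau> = "inv_into B \<tau>"
  \<comment> \<open>The glued inverses form a right inverse of \<open>\<rho>\<close> on the
    relabelled carrier, so \<open>s\<close> is recovered from its image under them.\<close>
  let ?\<rho> = "\<lambda>x. if x \<in> \<tau> ` B then ?\<tau> x else ?\<sigma> x"
  fix s assume s: "s \<in> Omega (\<sigma> ` A) (map_prod \<sigma> \<sigma> ` rA) (\<sigma> a) (\<tau> ` B) (map_prod \<tau> \<tau> ` rB)"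
  have inv: "?\<sigma> ` \<sigma> ` A = A" "?\<tau> ` \<tau> ` B = B" "?\<sigma> (\<sigma> a) = a"
    using inj AB(3) by simp_all
  have "map_prod ?\<rho> ?\<rho> ` s \<in> Omega (?\<sigma> ` \<sigma> ` A) (map_prod ?\<sigma> ?\<sigma> ` map_prod \<sigma> \<sigma> ` rA) (?\<sigma> (\<sigma> a))
      (?\<tau> ` \<tau> ` B) (map_prod ?\<tau> ?\<tau> ` map_prod \<tau> \<tau> ` rB)"
    by (rule Omega_image[OF inj(3) _ _ _ _ _ s]) (use AB inv in \<open>auto intro: inj_on_inv_into\<close>)
  moreover have "map_prod ?\<sigma> ?\<sigma> ` map_prod \<sigma> \<sigma> ` rA = rA"
    unfolding map_prod_image_comp by (rule map_prod_image_id[OF rA]) (use inj in simp)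
  moreover have "map_prod ?\<tau> ?\<tau> ` map_prod \<tau> \<tau> ` rB = rB"
    unfolding map_prod_image_comp by (rule map_prod_image_id[OF rB]) (use inj in simp)
  ultimately have "map_prod ?\<rho> ?\<rho> ` s \<in> Omega A rA a B rB"
    unfolding inv by simp
  moreover have "map_prod \<rho> \<rho> ` map_prod ?\<rho> ?\<rho> ` s = s"
    unfolding map_prod_image_comp
  proof (rule map_prod_image_id[OF partial_order_onD(1)[OF partial_order_on_Omega[OF s]]])
    fix x assume x: "x \<in> insert_at (\<sigma> ` A) (\<sigma> a) (\<tau> ` B)"
    show "(\<rho> \<circ> ?\<rho>) x = x"
    proof (cases "x \<in> \<tau> ` B")
      case True
      then show ?thesis by (simp add: \<rho>_def inv_into_into f_inv_into_f)
    next
      case False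
      then have "x \<in> \<sigma> ` A" using x by (auto simp: insert_at_def)
      then have "?\<sigma> x \<in> A" "\<sigma> (?\<sigma> x) = x" by (simp_all add: inv_into_into f_inv_into_f)
      then show ?thesis using False AB(1) by (auto simp: \<rho>_def)
    qed
  qed
  ultimately show "s \<in> image (map_prod \<rho> \<rho>) ` Omega A rA a B rB"
    by (rule rev_image_eqI[OF _ sym])
next
  fix s assume "s \<in> image (map_prod \<rho> \<rho>) ` Omega A rA a B rB"
  then obtain r where "s = map_prod \<rho> \<rho> ` r" "r \<in> Omega A rA a B rB" by (rule imageE)
  then show "s \<in> Omega (\<sigma> ` A) (map_prod \<sigma> \<sigma> ` rA) (\<sigma> a) (\<tau> ` B) (map_prod \<tau> \<tau> ` rB)"
    unfolding \<rho>_def by (simp only: Omega_image[OF AB inj])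
qed

section \<open>The operad of posets\<close>

lemma linear_betweenI:
  "linear_between scale V W f" if "\<And>x. x \<in> V \<Longrightarrow> f x \<in> W" "\<And>x y. f (x + y) = f x + f y"
    "\<And>c x. f (scale c x) = scale c (f x)"
  using that by (simp add: linear_between_def)

lemma poset_act_in_poset_space:
  assumes "inj_on \<sigma> A" "X \<in> poset_space A"
  shows "poset_act A \<sigma> X \<in> poset_space (\<sigma> ` A)"
  unfolding poset_act_def
  by (intro lin_extend_in_poset_space gen_in_poset_space partial_order_on_image
      poset_space_keysD[OF assms(2)] assms(1))

lemma linear_species_poset:
  "linear_species (fscale :: 'k::field \<Rightarrow> ('a rel \<Rightarrow>\<^sub>0 'k) \<Rightarrow> _) poset_space poset_act"
proof (intro linear_species.intro vector_space_fscale linear_species_axioms.intro)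
  fix A :: "'a set" and \<sigma> \<tau> :: "'a \<Rightarrow> 'a" and X :: "'a rel \<Rightarrow>\<^sub>0 'k"
  show "free.subspace (poset_space A)" by (rule subspace_poset_space)
  show "linear_between fscale (poset_space A) (poset_space (\<sigma> ` A)) (poset_act A \<sigma>)"
    if "inj_on \<sigma> A"
    using that poset_act_in_poset_space
    by (intro linear_betweenI) (auto simp: poset_act_def lin_extend_add lin_extend_scale)
  assume X: "X \<in> poset_space A"
  have keys: "r \<subseteq> A \<times> A" if "r \<in> Poly_Mapping.keys X" for r
    using partial_order_onD(1)[OF poset_space_keysD[OF X that]] .
  show "poset_act A \<sigma> X = poset_act A \<tau> X" if "\<And>x. x \<in> A \<Longrightarrow> \<sigma> x = \<tau> x"
    unfolding poset_act_def
    by (intro lin_extend_cong arg_cong[of _ _ gen] map_prod_image_cong[OF keys] that)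
  show "poset_act A id X = X"
    by (simp add: poset_act_def map_prod.id lin_extend_gen_id)
  show "poset_act (\<sigma> ` A) \<tau> (poset_act A \<sigma> X) = poset_act A (\<tau> \<circ> \<sigma>) X"
    by (simp add: poset_act_def lin_extend_lin_extend map_prod_image_comp)
qed

section \<open>Bilinear expansion of the composition laws\<close>

text \<open>A common normal form for iterated compositions, with the linear extensions outermost,
  reduces associativity to identities between double sums of generators.\<close>

lemma poset_comp_comp_left:
  "poset_comp D d C (poset_comp A a B X Y) Z =
    lin_extend (\<lambda>rA. lin_extend (\<lambda>rB. lin_extend (\<lambda>rC.
      \<Sum>r\<in>Omega A rA a B rB. \<Sum>s\<in>Omega D r d C rC. gen s) Z) Y) X"
  by (simp add: poset_comp_def lin_extend_lin_extend lin_extend_sum lin_extend_fun_sum)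

lemma poset_comp_comp_right:
  "poset_comp A a D X (poset_comp B b C Y Z) =
    lin_extend (\<lambda>rA. lin_extend (\<lambda>rB. lin_extend (\<lambda>rC.
      \<Sum>r\<in>Omega B rB b C rC. \<Sum>s\<in>Omega A rA a D r. gen s) Z) Y) X"
  by (simp add: poset_comp_def lin_extend_lin_extend lin_extend_sum)

text \<open>The index sets are disjoint because \<open>r\<close> is recovered from \<open>s\<close>
  as its quotient by \<open>C\<close>.\<close>

lemma sum_Omega_left:
  assumes "finite A" "finite B" "finite C"
  shows "(\<Sum>r\<in>Omega A rA a B rB. \<Sum>s\<in>Omega (insert_at A a B) r d C rC. gen s) =
    (\<Sum>s\<in>(\<Union>r\<in>Omega A rA a B rB. Omega (insert_at A a B) r d C rC). gen s)"
proof (rule sum.UNION_disjoint[symmetric])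
  show "\<forall>i\<in>Omega A rA a B rB. \<forall>j\<in>Omega A rA a B rB. i \<noteq> j \<longrightarrow>
      Omega (insert_at A a B) i d C rC \<inter> Omega (insert_at A a B) j d C rC = {}"
    unfolding Omega_def[of "insert_at A a B"] by blast
qed (use assms in \<open>auto intro!: finite_Omega simp: insert_at_def\<close>)

text \<open>Here disjointness holds because \<open>r\<close> is recovered from \<open>s\<close> by
  restriction to the composite block.\<close>

lemma sum_Omega_right:
  assumes "finite A" "finite B" "finite C"
  shows "(\<Sum>r\<in>Omega B rB b C rC. \<Sum>s\<in>Omega A rA a (insert_at B b C) r. gen s) =
    (\<Sum>s\<in>(\<Union>r\<in>Omega B rB b C rC. Omega A rA a (insert_at B b C) r). gen s)"
proof (rule sum.UNION_disjoint[symmetric])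
  show "\<forall>i\<in>Omega B rB b C rC. \<forall>j\<in>Omega B rB b C rC. i \<noteq> j \<longrightarrow>
      Omega A rA a (insert_at B b C) i \<inter> Omega A rA a (insert_at B b C) j = {}"
    unfolding Omega_def[of A] by blast
qed (use assms in \<open>auto intro!: finite_Omega simp: insert_at_def\<close>)

lemma poset_comp_in_poset_space:
  "poset_comp A a B X Y \<in> poset_space (insert_at A a B)"
  unfolding poset_comp_def
  by (intro lin_extend_in_poset_space free.subspace_sum subspace_poset_space gen_in_poset_space
      partial_order_on_Omega)

lemma poset_comp_natural:
  assumes "A \<inter> B = {}" "B \<noteq> {}" "a \<in> A"
    and inj: "inj_on \<sigma> A" "inj_on \<tau> B" "\<sigma> ` A \<inter> \<tau> ` B = {}"
    and X: "X \<in> poset_space A" and Y: "Y \<in> poset_space B"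
  shows "poset_act (insert_at A a B) (\<lambda>x. if x \<in> B then \<tau> x else \<sigma> x) (poset_comp A a B X Y)
    = poset_comp (\<sigma> ` A) (\<sigma> a) (\<tau> ` B) (poset_act A \<sigma> X) (poset_act B \<tau> Y)"
proof -
  let ?\<rho> = "\<lambda>x. if x \<in> B then \<tau> x else \<sigma> x"
  have "poset_act (insert_at A a B) ?\<rho> (poset_comp A a B X Y) =
      lin_extend (\<lambda>rA. lin_extend (\<lambda>rB. \<Sum>r\<in>Omega A rA a B rB. gen (map_prod ?\<rho> ?\<rho> ` r)) Y) X"
    by (simp add: poset_act_def poset_comp_def lin_extend_lin_extend lin_extend_sum)
  also have "\<dots> = lin_extend (\<lambda>rA. lin_extend (\<lambda>rB. \<Sum>s\<in>Omega (\<sigma> ` A) (map_prod \<sigma> \<sigma> ` rA)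
      (\<sigma> a) (\<tau> ` B) (map_prod \<tau> \<tau> ` rB). gen s) Y) X"
  proof (intro lin_extend_cong)
    fix rA rB assume "rA \<in> Poly_Mapping.keys X" "rB \<in> Poly_Mapping.keys Y"
    then have r: "rA \<subseteq> A \<times> A" "rB \<subseteq> B \<times> B"
      using partial_order_onD(1) poset_space_keysD X Y by blast+
    have "inj_on ?\<rho> (insert_at A a B)" by (rule inj_on_glue[OF inj])
    \<comment> \<open>Reindexing the sum requires distinct orders to have distinct relabellings;
      this is proved for all relations on the carrier and then restricted to
      \<open>Omega\<close>.\<close>
    then have "inj_on (image (map_prod ?\<rho> ?\<rho>)) (Pow (insert_at A a B \<times> insert_at A a B))"
      by (intro inj_on_image_Pow map_prod_inj_on)
    then have "inj_on (image (map_prod ?\<rho> ?\<rho>)) (Omega A rA a B rB)"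
      by (rule inj_on_subset) (rule Omega_subset)
    then show "(\<Sum>r\<in>Omega A rA a B rB. gen (map_prod ?\<rho> ?\<rho> ` r)) =
        (\<Sum>s\<in>Omega (\<sigma> ` A) (map_prod \<sigma> \<sigma> ` rA) (\<sigma> a) (\<tau> ` B) (map_prod \<tau> \<tau> ` rB). gen s)"
      by (simp add: Omega_natural[OF assms(1-6) r] sum.reindex)
  qed
  also have "\<dots> = poset_comp (\<sigma> ` A) (\<sigma> a) (\<tau> ` B) (poset_act A \<sigma> X) (poset_act B \<tau> Y)"
    by (simp add: poset_act_def poset_comp_def lin_extend_lin_extend)
  finally show ?thesis .
qed

theorem theorem2:
  shows "operad (fscale :: 'k::field \<Rightarrow> ('a rel \<Rightarrow>\<^sub>0 'k) \<Rightarrow> ('a rel \<Rightarrow>\<^sub>0 'k))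
    poset_space poset_act poset_comp poset_one"
proof (intro operad.intro linear_species_poset operad_axioms.intro)
  fix A B C :: "'a set" and a a' b :: 'a and \<sigma> \<tau> :: "'a \<Rightarrow> 'a"
    and X Y Z :: "'a rel \<Rightarrow>\<^sub>0 'k"
  show "linear_between fscale (poset_space A) (poset_space (insert_at A a B)) (\<lambda>X. poset_comp A a B X Y)"
    by (rule linear_betweenI)
       (rule poset_comp_in_poset_space, simp_all add: poset_comp_def lin_extend_add lin_extend_scale)
  show "linear_between fscale (poset_space B) (poset_space (insert_at A a B)) (poset_comp A a B X)"
    by (rule linear_betweenI)
       (rule poset_comp_in_poset_space, simp_all add: poset_comp_def lin_extend_add lin_extend_scale
         lin_extend_fun_add lin_extend_fun_scale)
  show "poset_act (insert_at A a B) (\<lambda>x. if x \<in> B then \<tau> x else \<sigma> x) (poset_comp A a B X Y)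
      = poset_comp (\<sigma> ` A) (\<sigma> a) (\<tau> ` B) (poset_act A \<sigma> X) (poset_act B \<tau> Y)"
    if "A \<inter> B = {}" "B \<noteq> {}" "a \<in> A" "inj_on \<sigma> A" "inj_on \<tau> B" "\<sigma> ` A \<inter> \<tau> ` B = {}"
      "X \<in> poset_space A" "Y \<in> poset_space B"
    using that by (rule poset_comp_natural)
  show "poset_comp (insert_at A a B) a' C (poset_comp A a B X Y) Z
      = poset_comp (insert_at A a' C) a B (poset_comp A a' C X Z) Y"
    if "finite A" "finite B" "finite C" "A \<inter> B = {}" "A \<inter> C = {}" "B \<inter> C = {}"
      "B \<noteq> {}" "C \<noteq> {}" "a \<in> A" "a' \<in> A" "a \<noteq> a'"
    unfolding poset_comp_comp_left sum_Omega_left[OF that(1,2,3)] sum_Omega_left[OF that(1,3,2)]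
      Omega_parallel[OF that(4-11)]
    \<comment> \<open>The right-hand side is expanded in the order \<open>X\<close>,
      \<open>Z\<close>, \<open>Y\<close>, so the two inner extensions are interchanged.\<close>
    by (subst lin_extend_swap[where Y = Y and X = Z]) (rule refl)
  show "poset_comp (insert_at A a B) b C (poset_comp A a B X Y) Z
      = poset_comp A a (insert_at B b C) X (poset_comp B b C Y Z)"
    if "finite A" "finite B" "finite C" "A \<inter> B = {}" "A \<inter> C = {}" "B \<inter> C = {}"
      "C \<noteq> {}" "a \<in> A" "b \<in> B"
    unfolding poset_comp_comp_left poset_comp_comp_right sum_Omega_left[OF that(1-3)]
      sum_Omega_right[OF that(1-3)] Omega_nested[OF that(4-9)] ..
  show "poset_one a \<in> poset_space {a}"
    unfolding poset_one_def by (rule gen_in_poset_space) (auto simp: partial_order_on_iff)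
  show "poset_act {a} \<sigma> (poset_one a) = poset_one (\<sigma> a)"
    by (simp add: poset_act_def poset_one_def)
  show "poset_comp {a} a B (poset_one a) Y = Y" if "B \<noteq> {}" "a \<notin> B" "Y \<in> poset_space B"
  proof -
    have "poset_comp {a} a B (poset_one a) Y = lin_extend gen Y"
      unfolding poset_comp_def poset_one_def lin_extend_gen
      \<comment> \<open>For each key \<open>rB\<close> of \<open>Y\<close> the sum has the single
        term \<open>gen rB\<close>.\<close>
      by (rule lin_extend_cong) (simp add: Omega_unit_left poset_space_keysD[OF that(3)] that(1,2))
    then show ?thesis by (simp add: lin_extend_gen_id)
  qed
  show "poset_comp A a {b} X (poset_one b) = poset_act A (id(a := b)) X"
    if "a \<in> A" "b \<notin> A" "X \<in> poset_space A"
    unfolding poset_comp_def poset_one_def poset_act_def lin_extend_gen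
    by (rule lin_extend_cong) (simp add: Omega_unit_right poset_space_keysD[OF that(3)] that(1,2))
qed

end
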